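(* Let $G$ be a countable (discrete) abelian group acting continuously on a compact metric space $X$, let $\mu$ be a $G$-invariant Borel probability measure on $X$, and fix a tempered Følner sequence $(F_n)$ in $G$. Suppose $(X,G,\mu)$ is minimal, uniquely ergodic, mixing of all orders, has minimal self-joinings of all orders, and has no weakly asymptotic pairs. Then $(X,G)$ has topological minimal self-joinings of all orders.
   Context: Let $d_X$ be the metric on $X$. Write $g^{\times N}(x_1,\dots,x_N)=(gx_1,\dots,gx_N)$. **Topological minimal self-joinings.** $(X,G)$ has $N$-fold topological minimal self-joinings ($N\ge2$) if for every $(x_1,\dots,x_N)\in X^{\times N}$ such that no two of the points $x_1,\dots,x_N$ lie in the same $G$-orbit, the orbit of $(x_1,\dots,x_N)$ under $\{g^{\times N}\}_{g\in G}$ is dense in $X^{\times N}$. It has them of all orders if this holds for every $N\ge2$. **Minimal / uniquely ergodic:** every orbit is dense / there is exactly one $G$-invariant Borel probability measure on $X$. **Mixing of all orders:** for every $N\ge1$ and Borel $A_0,\dots,A_N\subset X$, $\mu(g_0A_0\cap\dots\cap g_NA_N)\to\mu(A_0)\cdots\mu(A_N)$ as $g_i^{-1}g_j\to\infty$ for all $i\neq j$. **Joinings.** An $N$-fold self-joining is a $\{g^{\times N}\}_{g\in G}$-invariant Borel probability measure on $X^{\times N}$ with all one-coordinate marginals equal to $\mu$. Let ${}^N\Delta(A_1\times\dots\times A_N)=\mu(A_1\cap\dots\cap A_N)$, and for $\mathbf{g}=(g_1,\dots,g_N)\in G^N$ let ${}^N\Delta^{\mathbf g}=(g_1\times\dots\times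 g_N)_*{}^N\Delta$ (an off-diagonal joining, $G$ being abelian). A self-joining is trivial if, possibly after permuting coordinates, it is a direct product of off-diagonal joinings (including the one-fold joining $\mu$). The system has minimal self-joinings of all orders if for every $N\ge2$ every $N$-fold self-joining that is ergodic for $(X^{\times N},\{g^{\times N}\}_{g\in G})$ is trivial. **Weakly asymptotic pair.** For $D\subset G$ let $\bar d(D)=\limsup_n |F_n\cap D|/|F_n|$. Points $x\ne y$ of $X$ form a weakly asymptotic pair if there is $D\subset G$ with $\bar d(D)>0$ such that $d_X(gx,gy)\to0$ as $g\to\infty$ along $D$. *)

theory Defs
  imports "HOL-Probability.Probability"
begin

text \<open>
  The abelian group is a type of class \<open>ab_group_add\<close>, hence written additively
  (\<open>h - g\<close> stands for $g^{-1}h$), and an action of it on a space is a map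
  \<open>T :: 'g \<Rightarrow> 'x \<Rightarrow> 'x\<close>. The compact metric space is a whole type, and the power
  $X^{\times I}$ over a set \<open>I\<close> of coordinates is \<open>I \<rightarrow>\<^sub>E UNIV\<close>. For countable \<open>I\<close> the
  \<open>\<sigma>\<close>-algebra of \<open>\<Pi>\<^sub>M i\<in>I. borel\<close> is the Borel \<open>\<sigma>\<close>-algebra of the product topology, since a
  compact metric space is second countable. The coordinates \<open>1, \<dots>, N\<close> are numbered
  \<open>0, \<dots>, N - 1\<close>.
\<close>

definition continuous_action :: "('g::ab_group_add \<Rightarrow> 'x::topological_space \<Rightarrow> 'x) \<Rightarrow> bool" where
  "continuous_action T \<longleftrightarrow>
     (\<forall>x. T 0 x = x) \<and> (\<forall>g h x. T (g + h) x = T g (T h x)) \<and> (\<forall>g. continuous_on UNIV (T g))"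

definition orbit_of :: "('g \<Rightarrow> 'x \<Rightarrow> 'x) \<Rightarrow> 'x \<Rightarrow> 'x set" where
  "orbit_of T x = range (\<lambda>g. T g x)"

definition power_action :: "nat set \<Rightarrow> ('g \<Rightarrow> 'x \<Rightarrow> 'x) \<Rightarrow> 'g \<Rightarrow> (nat \<Rightarrow> 'x) \<Rightarrow> (nat \<Rightarrow> 'x)" where
  "power_action I T g x = (\<lambda>i\<in>I. T g (x i))"

subsection \<open>Topological notions\<close>

definition minimal_action :: "('g \<Rightarrow> 'x::topological_space \<Rightarrow> 'x) \<Rightarrow> bool" where
  "minimal_action T \<longleftrightarrow> (\<forall>x. closure (orbit_of T x) = UNIV)"

definition top_min_self_joinings ::
  "('g \<Rightarrow> 'x::topological_space \<Rightarrow> 'x) \<Rightarrow> nat \<Rightarrow> bool" where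
  "top_min_self_joinings T N \<longleftrightarrow>
     (\<forall>x \<in> {..<N} \<rightarrow>\<^sub>E UNIV.
        (\<forall>i<N. \<forall>j<N. i \<noteq> j \<longrightarrow> x j \<notin> orbit_of T (x i)) \<longrightarrow>
        product_topology (\<lambda>_. euclidean) {..<N} closure_of orbit_of (power_action {..<N} T) x
          = {..<N} \<rightarrow>\<^sub>E UNIV)"

definition top_min_self_joinings_all_orders ::
  "('g \<Rightarrow> 'x::topological_space \<Rightarrow> 'x) \<Rightarrow> bool" where
  "top_min_self_joinings_all_orders T \<longleftrightarrow> (\<forall>N\<ge>2. top_min_self_joinings T N)"

subsection \<open>Measure-theoretic notions\<close>

definition invariant_prob ::
  "('g \<Rightarrow> 'x::topological_space \<Rightarrow> 'x) \<Rightarrow> 'x measure \<Rightarrow> bool" where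
  "invariant_prob T M \<longleftrightarrow>
     sets M = sets borel \<and> prob_space M \<and> (\<forall>g. distr M borel (T g) = M)"

definition uniquely_ergodic :: "('g \<Rightarrow> 'x::topological_space \<Rightarrow> 'x) \<Rightarrow> bool" where
  "uniquely_ergodic T \<longleftrightarrow> (\<exists>!M. invariant_prob T M)"

definition ergodic_for :: "('g \<Rightarrow> 'y \<Rightarrow> 'y) \<Rightarrow> 'y measure \<Rightarrow> bool" where
  "ergodic_for S M \<longleftrightarrow>
     (\<forall>A\<in>sets M. (\<forall>g. S g -` A \<inter> space M = A) \<longrightarrow> measure M A = 0 \<or> measure M A = 1)"

text \<open>
  In the discrete group, \<open>g \<rightarrow> \<infinity>\<close> means convergence along \<^const>\<open>cofinite\<close>. The infimum of filters
  expresses that all the differences tend to infinity simultaneously.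
\<close>

definition mixing_all_orders ::
  "('g::ab_group_add \<Rightarrow> 'x::topological_space \<Rightarrow> 'x) \<Rightarrow> 'x measure \<Rightarrow> bool" where
  "mixing_all_orders T \<mu> \<longleftrightarrow>
     (\<forall>N\<ge>1. \<forall>A :: nat \<Rightarrow> 'x set. (\<forall>i\<le>N. A i \<in> sets borel) \<longrightarrow>
        ((\<lambda>g :: nat \<Rightarrow> 'g. measure \<mu> (\<Inter>i\<le>N. T (g i) ` A i)) \<longlongrightarrow> (\<Prod>i\<le>N. measure \<mu> (A i)))
          (INF (i, j) \<in> {(i, j). i \<le> N \<and> j \<le> N \<and> i \<noteq> j}.
             filtercomap (\<lambda>g. g j - g i) cofinite))"

subsection \<open>Joinings\<close>

definition self_joining ::
  "('g \<Rightarrow> 'x::topological_space \<Rightarrow> 'x) \<Rightarrow> 'x measure \<Rightarrow> nat \<Rightarrow> (nat \<Rightarrow> 'x) measure \<Rightarrow> bool" where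
  "self_joining T \<mu> N M \<longleftrightarrow>
     sets M = sets (\<Pi>\<^sub>M i\<in>{..<N}. borel) \<and> prob_space M \<and>
     (\<forall>g. distr M (\<Pi>\<^sub>M i\<in>{..<N}. borel) (power_action {..<N} T g) = M) \<and>
     (\<forall>i<N. distr M borel (\<lambda>x. x i) = \<mu>)"

definition diagonal_joining ::
  "'x::topological_space measure \<Rightarrow> nat set \<Rightarrow> (nat \<Rightarrow> 'x) measure" where
  "diagonal_joining \<mu> I = distr \<mu> (\<Pi>\<^sub>M i\<in>I. borel) (\<lambda>x. \<lambda>i\<in>I. x)"

lemma emeasure_diagonal_joining:
  assumes "sets \<mu> = sets borel" "finite I" "I \<noteq> {}" "\<And>i. i \<in> I \<Longrightarrow> A i \<in> sets borel"
  shows "emeasure (diagonal_joining \<mu> I) (\<Pi>\<^sub>E i\<in>I. A i) = emeasure \<mu> (\<Inter>i\<in>I. A i)"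
proof -
  have [measurable_cong]: "sets \<mu> = sets borel" by (rule assms)
  have sp: "space \<mu> = UNIV" using sets_eq_imp_space_eq[OF assms(1)] by simp
  have "(\<lambda>x. \<lambda>i\<in>I. x) \<in> measurable \<mu> (\<Pi>\<^sub>M i\<in>I. borel)"
    by measurable
  moreover have "(\<Pi>\<^sub>E i\<in>I. A i) \<in> sets (\<Pi>\<^sub>M i\<in>I. borel)"
    using assms by (intro sets_PiM_I_finite) auto
  moreover have "(\<lambda>x. \<lambda>i\<in>I. x) -` (\<Pi>\<^sub>E i\<in>I. A i) \<inter> space \<mu> = (\<Inter>i\<in>I. A i)"
    using \<open>I \<noteq> {}\<close> by (auto simp: sp PiE_iff)
  ultimately show ?thesis
    unfolding diagonal_joining_def by (simp add: emeasure_distr)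
qed

definition off_diagonal_joining ::
  "('g \<Rightarrow> 'x::topological_space \<Rightarrow> 'x) \<Rightarrow> 'x measure \<Rightarrow> nat set \<Rightarrow> (nat \<Rightarrow> 'g) \<Rightarrow> (nat \<Rightarrow> 'x) measure"
  where
  "off_diagonal_joining T \<mu> I g =
     distr (diagonal_joining \<mu> I) (\<Pi>\<^sub>M i\<in>I. borel) (\<lambda>x. \<lambda>i\<in>I. T (g i) (x i))"

text \<open>
  A direct product of joinings, up to a permutation of the coordinates, is given by a partition of
  the coordinates into nonempty blocks and a joining on each block. The blocks are the fibres of a
  labelling \<open>b\<close>. A point of the product of the powers over the blocks is a family \<open>w\<close> with
  \<open>w k\<close> in the power over the block labelled \<open>k\<close>, and the map \<open>w \<mapsto> (w (b i) i)\<^sub>i\<close> identifies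
  this product with the power over \<open>{..<N}\<close>.
\<close>

definition trivial_joining ::
  "('g \<Rightarrow> 'x::topological_space \<Rightarrow> 'x) \<Rightarrow> 'x measure \<Rightarrow> nat \<Rightarrow> (nat \<Rightarrow> 'x) measure \<Rightarrow> bool" where
  "trivial_joining T \<mu> N M \<longleftrightarrow>
     (\<exists>(b :: nat \<Rightarrow> nat) g.
        M = distr (\<Pi>\<^sub>M k\<in>b ` {..<N}. off_diagonal_joining T \<mu> {i. i < N \<and> b i = k} g)
              (\<Pi>\<^sub>M i\<in>{..<N}. borel)
              (\<lambda>w. \<lambda>i\<in>{..<N}. w (b i) i))"

definition min_self_joinings_all_orders ::
  "('g \<Rightarrow> 'x::topological_space \<Rightarrow> 'x) \<Rightarrow> 'x measure \<Rightarrow> bool" where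
  "min_self_joinings_all_orders T \<mu> \<longleftrightarrow>
     (\<forall>N\<ge>2. \<forall>M. self_joining T \<mu> N M \<and> ergodic_for (power_action {..<N} T) M \<longrightarrow>
        trivial_joining T \<mu> N M)"

subsection \<open>Tempered F{\o}lner sequences and weakly asymptotic pairs\<close>

definition folner_sequence :: "(nat \<Rightarrow> 'g::ab_group_add set) \<Rightarrow> bool" where
  "folner_sequence F \<longleftrightarrow>
     (\<forall>n. finite (F n) \<and> F n \<noteq> {}) \<and>
     (\<forall>g. (\<lambda>n. real (card (sym_diff ((\<lambda>h. g + h) ` F n) (F n))) / real (card (F n)))
            \<longlonglongrightarrow> 0)"

definition tempered :: "(nat \<Rightarrow> 'g::ab_group_add set) \<Rightarrow> bool" where
  "tempered F \<longleftrightarrow>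
     (\<exists>C::real. \<forall>n. real (card (\<Union>k<n. {- a + c |a c. a \<in> F k \<and> c \<in> F n})) \<le> C * real (card (F n)))"

definition upper_density :: "(nat \<Rightarrow> 'g set) \<Rightarrow> 'g set \<Rightarrow> ereal" where
  "upper_density F D = limsup (\<lambda>n. ereal (real (card (F n \<inter> D)) / real (card (F n))))"

definition weakly_asymptotic_pair ::
  "(nat \<Rightarrow> 'g set) \<Rightarrow> ('g \<Rightarrow> 'x::metric_space \<Rightarrow> 'x) \<Rightarrow> 'x \<Rightarrow> 'x \<Rightarrow> bool" where
  "weakly_asymptotic_pair F T x y \<longleftrightarrow>
     x \<noteq> y \<and>
     (\<exists>D. upper_density F D > 0 \<and>
        ((\<lambda>g. dist (T g x) (T g y)) \<longlongrightarrow> 0) (inf cofinite (principal D)))"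

end

theory Submission
  imports Defs
begin

text \<open>
  Suppose the orbit of a point \<open>x\<close> of \<open>X\<^sup>N\<close>, whose coordinates lie in different orbits, misses an open
  rectangle \<open>U = U\<^sub>0 \<times> \<dots> \<times> U\<^sub>N\<^sub>-\<^sub>1\<close>. Let \<open>Y\<close> be the compact invariant set of all points whose orbits miss
  \<open>U\<close>. Every ergodic invariant measure on \<open>Y\<close> is a self-joining by unique ergodicity, hence trivial:
  a product of off-diagonal joinings over blocks of coordinates, with shifts \<open>g\<^sub>i\<close>. It gives \<open>U\<close> the
  product over the blocks \<open>J\<close> of the measures of the sets \<open>\<Inter>i\<in>J. T (g i) -` U\<^sub>i\<close>, and this product must
  be zero. The sets \<open>U\<^sub>i\<close> have positive measure by minimality, so mixing of all orders provides a
  finite set \<open>E\<close> of group elements such that the product is positive as soon as \<open>g\<^sub>i - g\<^sub>j\<close> avoids \<open>E\<close>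
  for all distinct \<open>i, j\<close> in the same block (\<open>mixing_blocks_positive\<close>). Hence each ergodic measure on
  \<open>Y\<close> is carried by one of the finitely many graphs \<open>y\<^sub>i = T h y\<^sub>j\<close> with \<open>h \<in> E\<close>.

  This contradicts the absence of weakly asymptotic pairs. Let \<open>f\<close> be the product of the distances
  between \<open>y\<^sub>i\<close> and \<open>T h y\<^sub>j\<close> over all \<open>i \<noteq> j\<close> and \<open>h \<in> E\<close>; it vanishes on those graphs. As \<open>x\<^sub>i\<close> and
  \<open>T h x\<^sub>j\<close> are distinct and not weakly asymptotic, they are close only for a set of times of small
  density (\<open>not_weakly_asymptotic_imp_rarely_close\<close>), so the Folner averages of \<open>f\<close> along the orbit
  of \<open>x\<close> stay bounded away from zero. An invariant measure on \<open>Y\<close> with positive integral of \<open>f\<close> is a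
  weak limit of empirical measures; what is needed is an ergodic one
  (\<open>ergodic_measure_with_positive_integral\<close>).

  It is found by a variational principle. The compact space \<open>Y\<close> is a continuous image of a compact
  set of reals, on which Helly's theorem makes the space of distributions sequentially compact. A
  strictly convex, weakly continuous functional, the squared weighted \<open>L\<^sup>2\<close> norm of the distribution
  function, is added with a small factor to the integral of \<open>f\<close>. A maximiser among the invariant
  distributions cannot be a nontrivial convex combination of invariant ones, so it is ergodic.
\<close>

section \<open>Coding compact metric spaces by real numbers\<close>

text \<open>
  The first nonzero digit, at position \<open>k\<close>, contributes \<open>3\<^sup>-\<^sup>k\<close> in absolute value, and all later digits
  together at most half of that. Binary expansions have no such gap.
\<close>
lemma ternary_small_imp_zero_digits:
  fixes d :: "nat \<Rightarrow> real"
  assumes digit: "\<And>k. d k \<in> {-1, 0, 1}"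
    and small: "\<bar>\<Sum>k. d k * (1/3)^k\<bar> < (1/3)^m / 2"
    and "k \<le> m"
  shows "d k = 0"
  using \<open>k \<le> m\<close>
proof (induction k rule: less_induct)
  case (less k)
  have bnd: "\<bar>d i\<bar> \<le> 1" for i
    using digit[of i] by auto
  have sm: "summable (\<lambda>i. d i * (1/3)^i)"
    by (rule summable_comparison_test'[where g = "\<lambda>i. (1/3)^i" and N = 0])
      (use bnd in \<open>auto simp: abs_mult intro!: mult_left_le_one_le\<close>)
  have sm': "summable (\<lambda>i. d (i + Suc k) * (1/3)^(i + Suc k))"
    using sm by (subst summable_iff_shift)
  have geo: "(\<lambda>i. (1/3::real)^(i + Suc k)) sums ((1/3)^k / 2)"
    using sums_mult2[OF geometric_sums[of "1/3::real"], of "(1/3)^Suc k"]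
    by (simp add: power_add)
  have "(\<Sum>i. d i * (1/3)^i) = (\<Sum>i. d (i + Suc k) * (1/3)^(i + Suc k)) + (\<Sum>i<Suc k. d i * (1/3)^i)"
    by (rule suminf_split_initial_segment[OF sm])
  also have "(\<Sum>i<Suc k. d i * (1/3)^i) = d k * (1/3)^k"
    using less by (simp add: lessThan_Suc)
  finally have eq: "(\<Sum>i. d i * (1/3)^i) = (\<Sum>i. d (i + Suc k) * (1/3)^(i + Suc k)) + d k * (1/3)^k" .
  have "norm (\<Sum>i. d (i + Suc k) * (1/3)^(i + Suc k)) \<le> (\<Sum>i. (1/3)^(i + Suc k))"
    by (rule norm_suminf_le)
      (use bnd sums_summable[OF geo] in \<open>auto simp: abs_mult intro!: mult_left_le_one_le simp del: power_Suc\<close>)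
  then have tail: "\<bar>\<Sum>i. d (i + Suc k) * (1/3)^(i + Suc k)\<bar> \<le> (1/3)^k / 2"
    using sums_unique[OF geo] by simp
  show "d k = 0"
  proof (rule ccontr)
    assume "d k \<noteq> 0"
    then have "\<bar>d k * (1/3)^k\<bar> = (1/3)^k"
      using digit[of k] by (auto simp: abs_mult)
    then have "(1/3)^k / 2 \<le> \<bar>\<Sum>i. d i * (1/3)^i\<bar>"
      using tail eq by linarith
    moreover have "(1/3::real)^m \<le> (1/3)^k"
      using less.prems by (intro power_decreasing) auto
    ultimately show False using small by linarith
  qed
qed

text \<open>
  A compact metric space is a continuous image of a compact set of reals. The code \<open>s y\<close> records in
  ternary digits which balls of a countable family contain \<open>y\<close>; finitely many of these balls form an
  \<open>e\<close>-net, so points with close codes are close. The inverse of \<open>s\<close> is thus uniformly continuous,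
  and \<open>q\<close> is its extension to the closure \<open>K\<close> of the set of codes. The code itself may be very
  discontinuous. Outside \<open>K\<close> the map \<open>q\<close> is constant, which keeps it Borel measurable.
\<close>
lemma compact_metric_real_code:
  fixes Y :: "'y::metric_space set"
  assumes "compact Y" "Y \<noteq> {}"
  obtains K :: "real set" and q :: "real \<Rightarrow> 'y" and s :: "'y \<Rightarrow> real" and y0
  where "compact K" "continuous_on K q" "\<And>t. q t \<in> Y" "\<And>t. t \<notin> K \<Longrightarrow> q t = y0"
    "\<And>y. y \<in> Y \<Longrightarrow> s y \<in> K" "\<And>y. y \<in> Y \<Longrightarrow> q (s y) = y"
proof -
  have "\<exists>k. finite k \<and> Y \<subseteq> (\<Union>c\<in>k. ball c (1 / real (Suc n)))" for n
    using assms(1) unfolding compact_eq_totally_bounded by simp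
  then obtain net where net: "\<And>n. finite (net n)"
      "\<And>n. Y \<subseteq> (\<Union>c\<in>net n. ball c (1 / real (Suc n)))"
    by metis
  define \<B> where "\<B> = (\<Union>n. (\<lambda>c. ball c (1 / real (Suc n))) ` net n)"
  have "countable \<B>" unfolding \<B>_def using net(1) by (auto intro: countable_finite)
  moreover have "\<B> \<noteq> {}"
    using net(2)[of 0] \<open>Y \<noteq> {}\<close> unfolding \<B>_def by fastforce
  ultimately obtain B :: "nat \<Rightarrow> 'y set" where B: "range B = \<B>"
    by (metis range_from_nat_into)
  define s :: "'y \<Rightarrow> real" where "s y = (\<Sum>k. (if y \<in> B k then 1 else 0) * (1/3)^k)" for y
  have sm: "summable (\<lambda>k. (if y \<in> B k then 1 else 0) * (1/3::real)^k)" for y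
    by (rule summable_comparison_test'[where g = "\<lambda>i. (1/3)^i" and N = 0]) auto
  \<comment> \<open>Points with the same first digits lie in the same ball of a fine net.\<close>
  have close: "\<exists>\<delta>>0. \<forall>y\<in>Y. \<forall>y'\<in>Y. \<bar>s y - s y'\<bar> < \<delta> \<longrightarrow> dist y y' < e" if "e > 0" for e
  proof -
    obtain n where n: "1 / real (Suc n) < e / 2"
      using \<open>e > 0\<close> by (metis half_gt_zero nat_approx_posE)
    have "\<exists>k. B k = ball c (1 / real (Suc n))" if "c \<in> net n" for c
    proof -
      have "ball c (1 / real (Suc n)) \<in> range B"
        unfolding B \<B>_def using that by blast
      then show ?thesis by (auto simp: image_iff)
    qed
    then obtain \<kappa> where \<kappa>: "\<And>c. c \<in> net n \<Longrightarrow> B (\<kappa> c) = ball c (1 / real (Suc n))"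
      by metis
    obtain m where m: "\<And>c. c \<in> net n \<Longrightarrow> \<kappa> c \<le> m"
      using finite_nat_set_iff_bounded_le[of "\<kappa> ` net n"] net(1) by auto
    have "dist y y' < e" if "y \<in> Y" "y' \<in> Y" "\<bar>s y - s y'\<bar> < (1/3)^m / 2" for y y'
    proof -
      define d :: "nat \<Rightarrow> real" where "d k = (if y \<in> B k then 1 else 0) - (if y' \<in> B k then 1 else 0)" for k
      have "s y - s y' = (\<Sum>k. d k * (1/3)^k)"
        unfolding s_def d_def using suminf_diff[OF sm sm] by (simp add: left_diff_distrib)
      then have d0: "d k = 0" if "k \<le> m" for k
        using ternary_small_imp_zero_digits[of d m k] that \<open>\<bar>s y - s y'\<bar> < _\<close>
        by (auto simp: d_def)
      obtain c where c: "c \<in> net n" "y \<in> ball c (1 / real (Suc n))"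
        using net(2) \<open>y \<in> Y\<close> by blast
      then have "y \<in> B (\<kappa> c)" using \<kappa> by simp
      then have "y' \<in> B (\<kappa> c)"
        using d0[OF m[OF c(1)]] unfolding d_def by (simp split: if_splits)
      then have "dist c y' < e / 2" "dist c y < e / 2"
        using \<kappa>[OF c(1)] c(2) n by auto
      then show ?thesis
        using dist_triangle_half_r by blast
    qed
    then show ?thesis by (intro exI[of _ "(1/3)^m / 2"]) auto
  qed
  define K where "K = closure (s ` Y)"
  have "s y \<in> {0..3/2}" for y
  proof -
    have "norm (s y) \<le> (\<Sum>k. (1/3::real)^k)"
      unfolding s_def by (rule norm_suminf_le) auto
    moreover have "s y \<ge> 0" unfolding s_def by (intro suminf_nonneg sm) auto
    ultimately show ?thesis by (simp add: suminf_geometric)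
  qed
  then have "s ` Y \<subseteq> {0..3/2}" by blast
  then have "compact K"
    unfolding K_def compact_closure by (rule bounded_subset[OF bounded_closed_interval])
  have ex: "\<exists>y\<in>Y. \<forall>e>0. \<exists>y'\<in>Y. \<bar>s y' - t\<bar> < e \<and> dist y' y < e" if t: "t \<in> K" for t
  proof -
    from t obtain a where a: "\<And>n. a n \<in> s ` Y" "a \<longlonglongrightarrow> t"
      unfolding K_def closure_sequential by blast
    from a(1) have "\<forall>n. \<exists>z. z \<in> Y \<and> a n = s z" by blast
    then obtain z where z: "\<And>n. z n \<in> Y" "\<And>n. a n = s (z n)" by metis
    obtain y r where y: "y \<in> Y" "strict_mono (r::nat\<Rightarrow>nat)" "(z \<circ> r) \<longlonglongrightarrow> y"
      using \<open>compact Y\<close> z(1) unfolding compact_def by blast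
    have lim: "(a \<circ> r) \<longlonglongrightarrow> t" by (rule LIMSEQ_subseq_LIMSEQ[OF a(2) y(2)])
    have "\<exists>y'\<in>Y. \<bar>s y' - t\<bar> < e \<and> dist y' y < e" if "e > 0" for e
    proof -
      have "\<forall>\<^sub>F n in sequentially. dist ((a \<circ> r) n) t < e \<and> dist ((z \<circ> r) n) y < e"
        using lim y(3) \<open>e > 0\<close> by (intro eventually_conj tendstoD)
      then obtain n where "dist ((a \<circ> r) n) t < e \<and> dist ((z \<circ> r) n) y < e"
        using eventually_happens'[OF sequentially_bot] by blast
      then show ?thesis using z by (auto simp: dist_real_def)
    qed
    then show ?thesis using y(1) by blast
  qed
  \<comment> \<open>\<open>P t y\<close> says that \<open>y\<close> is a limit of points whose codes tend to \<open>t\<close>.\<close>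
  define P where "P t y \<longleftrightarrow> y \<in> Y \<and> (\<forall>e>0. \<exists>y'\<in>Y. \<bar>s y' - t\<bar> < e \<and> dist y' y < e)" for t y
  obtain y0 where "y0 \<in> Y" using \<open>Y \<noteq> {}\<close> by blast
  define q where "q t = (if t \<in> K then SOME y. P t y else y0)" for t
  have qP: "P t (q t)" if "t \<in> K" for t
  proof -
    have "\<exists>y. P t y" using ex[OF that] unfolding P_def by blast
    then have "P t (SOME y. P t y)" by (rule someI_ex)
    then show ?thesis using that by (simp add: q_def)
  qed
  have unif: "\<exists>\<delta>>0. \<forall>t t' y y'. P t y \<longrightarrow> P t' y' \<longrightarrow> \<bar>t - t'\<bar> < \<delta> \<longrightarrow> dist y y' < e" if "e > 0" for e
  proof -
    obtain \<delta> where \<delta>: "\<delta> > 0" "\<And>y y'. y \<in> Y \<Longrightarrow> y' \<in> Y \<Longrightarrow> \<bar>s y - s y'\<bar> < \<delta> \<Longrightarrow> dist y y' < e / 3"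
      using close[of "e/3"] \<open>e > 0\<close> by auto
    have "dist y y' < e" if "P t y" "P t' y'" "\<bar>t - t'\<bar> < \<delta> / 3" for t t' y y'
    proof -
      define \<eta> where "\<eta> = min (\<delta> / 3) (e / 3)"
      have "\<eta> > 0" using \<open>\<delta> > 0\<close> \<open>e > 0\<close> by (simp add: \<eta>_def)
      obtain z where z: "z \<in> Y" "\<bar>s z - t\<bar> < \<eta>" "dist z y < \<eta>"
        using \<open>P t y\<close> \<open>\<eta> > 0\<close> unfolding P_def by blast
      obtain z' where z': "z' \<in> Y" "\<bar>s z' - t'\<bar> < \<eta>" "dist z' y' < \<eta>"
        using \<open>P t' y'\<close> \<open>\<eta> > 0\<close> unfolding P_def by blast
      have "\<bar>s z - s z'\<bar> < \<delta>" using z z' that(3) unfolding \<eta>_def by linarith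
      then have "dist z z' < e / 3" using \<delta>(2) z z' by blast
      moreover have "dist y y' \<le> dist z y + dist z z' + dist z' y'"
        using dist_triangle[of y y' z] dist_triangle[of z y' z'] by (simp add: dist_commute)
      ultimately show ?thesis using z z' unfolding \<eta>_def by linarith
    qed
    then show ?thesis using \<open>\<delta> > 0\<close> by (intro exI[of _ "\<delta>/3"]) auto
  qed
  show ?thesis
  proof
    show "compact K" by fact
    show "continuous_on K q"
      unfolding continuous_on_iff
    proof (intro ballI allI impI)
      fix t e assume "t \<in> K" "(e::real) > 0"
      moreover obtain \<delta> where "\<delta> > 0"
          "\<And>t t' y y'. P t y \<Longrightarrow> P t' y' \<Longrightarrow> \<bar>t - t'\<bar> < \<delta> \<Longrightarrow> dist y y' < e"
        using unif[OF \<open>e > 0\<close>] by blast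
      ultimately show "\<exists>d>0. \<forall>t'\<in>K. dist t' t < d \<longrightarrow> dist (q t') (q t) < e"
        using qP unfolding dist_real_def by (intro exI[of _ \<delta>]) blast
    qed
    show "q t \<in> Y" for t using qP[of t] \<open>y0 \<in> Y\<close> unfolding P_def by (cases "t \<in> K") (auto simp: q_def)
    show "q t = y0" if "t \<notin> K" for t using that by (simp add: q_def)
    show sK: "s y \<in> K" if "y \<in> Y" for y
      using closure_subset[of "s ` Y"] that unfolding K_def by auto
    show "q (s y) = y" if "y \<in> Y" for y
    proof (rule ccontr)
      assume ne: "q (s y) \<noteq> y"
      have "P (s y) y"
        using that unfolding P_def by (auto intro!: bexI[of _ y])
      moreover obtain \<delta> where "\<delta> > 0"
          "\<And>t t' z z'. P t z \<Longrightarrow> P t' z' \<Longrightarrow> \<bar>t - t'\<bar> < \<delta> \<Longrightarrow> dist z z' < dist (q (s y)) y"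
        using unif[of "dist (q (s y)) y"] ne by auto
      ultimately show False
        using qP[OF sK[OF that]] by fastforce
    qed
  qed
qed

lemma borel_measurable_continuous_code:
  fixes q :: "real \<Rightarrow> 'y::topological_space" and w :: "'y \<Rightarrow> 'z::topological_space"
  assumes "closed K" "continuous_on K q" "\<And>t. t \<notin> K \<Longrightarrow> q t = y0" "\<And>t. q t \<in> Y"
    and "continuous_on Y w"
  shows "(\<lambda>t. w (q t)) \<in> borel_measurable borel"
proof -
  have "continuous_on K (\<lambda>t. w (q t))"
    using assms by (intro continuous_on_compose2[of Y w K q]) auto
  then have "(\<lambda>t. if t \<in> K then w (q t) else w y0) \<in> borel_measurable borel"
    using \<open>closed K\<close> by (intro borel_measurable_continuous_on_if) auto
  moreover have "(\<lambda>t. if t \<in> K then w (q t) else w y0) = (\<lambda>t. w (q t))"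
    using assms(3) by auto
  ultimately show ?thesis by simp
qed

section \<open>Weak limits and a strictly convex functional on distributions\<close>

lemma AE_supported:
  assumes "real_distribution M" "closed K" "measure M K = 1"
  shows "AE t in M. t \<in> K"
proof -
  interpret real_distribution M by fact
  have "K \<in> events" using \<open>closed K\<close> by simp
  then show ?thesis using AE_prob_1 \<open>measure M K = 1\<close> by blast
qed

text \<open>
  Weak convergence tests against functions continuous on the whole line, whereas a function of the
  coded point is continuous only on \<open>K\<close>; Tietze's theorem bridges the gap.
\<close>
lemma weak_conv_integral_continuous_on_support:
  fixes w :: "real \<Rightarrow> real"
  assumes conv: "weak_conv_m M L"
    and M: "\<And>n. real_distribution (M n)" "\<And>n. measure (M n) K = 1"
    and L: "real_distribution L" "measure L K = 1"
    and "compact K" and w: "continuous_on K w" "w \<in> borel_measurable borel"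
  shows "(\<lambda>n. \<integral>t. w t \<partial>M n) \<longlonglongrightarrow> (\<integral>t. w t \<partial>L)"
proof -
  have "closed K" using \<open>compact K\<close> by (rule compact_imp_closed)
  have "bounded (w ` K)"
    using compact_continuous_image[OF w(1) \<open>compact K\<close>] by (rule compact_imp_bounded)
  then obtain B where B: "B > 0" "\<And>t. t \<in> K \<Longrightarrow> norm (w t) \<le> B"
    unfolding bounded_pos by auto
  obtain g where g: "continuous_on UNIV g" "\<And>t. t \<in> K \<Longrightarrow> g t = w t" "\<And>t. norm (g t) \<le> B"
    using Tietze[of K w UNIV B] w(1) \<open>closed K\<close> B by auto
  have [measurable]: "g \<in> borel_measurable borel"
    using g(1) by (rule borel_measurable_continuous_onI)
  have eq: "(\<integral>t. w t \<partial>D) = (\<integral>t. g t \<partial>D)" if D: "real_distribution D" "measure D K = 1" for D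
  proof (rule integral_cong_AE)
    interpret real_distribution D by fact
    show "w \<in> borel_measurable D" "g \<in> borel_measurable D"
      using w(2) by simp_all
    show "AE t in D. w t = g t"
      using AE_supported[OF D(1) \<open>closed K\<close> D(2)] by eventually_elim (simp add: g(2))
  qed
  have "(\<lambda>n. \<integral>t. g t \<partial>M n) \<longlonglongrightarrow> (\<integral>t. g t \<partial>L)"
  proof (rule weak_conv_imp_integral_bdd_continuous_conv[OF M(1) L(1) conv])
    show "isCont g t" for t
      using g(1) by (simp add: continuous_on_eq_continuous_at)
    show "norm (g t) \<le> B" for t by (rule g(3))
  qed
  then show ?thesis using eq M L by simp
qed

text \<open>
  Helly's theorem. That no mass leaves \<open>K\<close> in the limit is seen by integrating the distance to \<open>K\<close>.
\<close>
lemma seq_compact_distributions: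
  fixes K :: "real set"
  assumes M: "\<And>n. real_distribution (M n)" "\<And>n. measure (M n) K = 1" and "compact K"
  obtains r L where "strict_mono (r :: nat \<Rightarrow> nat)" "real_distribution L" "measure L K = 1"
    "weak_conv_m (M \<circ> r) L"
proof -
  have "closed K" using \<open>compact K\<close> by (rule compact_imp_closed)
  obtain B where B: "\<And>t. t \<in> K \<Longrightarrow> \<bar>t\<bar> \<le> B" "B > 0"
    using compact_imp_bounded[OF \<open>compact K\<close>] unfolding bounded_pos by auto
  have "tight M"
    unfolding tight_def
  proof (intro conjI allI impI)
    show "real_distribution (M n)" for n by (rule M)
    fix e :: real assume "e > 0"
    have "1 - e < measure (M n) {-B-1<..B}" for n
    proof -
      interpret real_distribution "M n" by (rule M)
      have "K \<subseteq> {-B-1<..B}" using B by fastforce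
      then have "measure (M n) K \<le> measure (M n) {-B-1<..B}"
        by (intro finite_measure_mono) auto
      then show ?thesis using M(2)[of n] \<open>e > 0\<close> by linarith
    qed
    then show "\<exists>a b. a < b \<and> (\<forall>n. 1 - e < measure (M n) {a<..b})"
      using B(2) by (intro exI[of _ "-B-1"] exI[of _ B]) auto
  qed
  then obtain r L where r: "strict_mono (r :: nat \<Rightarrow> nat)" "real_distribution L"
      "weak_conv_m (M \<circ> id \<circ> r) L"
    using tight_imp_convergent_subsubsequence[of M id] strict_mono_id by blast
  interpret L: real_distribution L by fact
  have Mr: "real_distribution ((M \<circ> r) n)" for n using M by simp
  have ne: "K \<noteq> {}" using M(2)[of 0] by auto
  define u where "u t = min 1 (infdist t K)" for t :: real
  have [measurable]: "u \<in> borel_measurable borel"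
    unfolding u_def by (intro borel_measurable_continuous_onI continuous_intros)
  have "(\<lambda>n. \<integral>t. u t \<partial>(M \<circ> r) n) \<longlonglongrightarrow> (\<integral>t. u t \<partial>L)"
  proof (rule weak_conv_imp_integral_bdd_continuous_conv[OF Mr r(2)])
    show "weak_conv_m (M \<circ> r) L" using r(3) by simp
    show "isCont u t" for t
      unfolding u_def by (intro continuous_intros)
    show "norm (u t) \<le> 1" for t by (auto simp: u_def infdist_nonneg)
  qed
  moreover have "(\<integral>t. u t \<partial>(M \<circ> r) n) = 0" for n
  proof -
    have "AE t in (M \<circ> r) n. u t = 0"
      using AE_supported[OF Mr \<open>closed K\<close>, of n] M(2) by (auto simp: u_def elim: eventually_mono)
    then show ?thesis by (rule integral_eq_zero_AE)
  qed
  ultimately have u0: "(\<integral>t. u t \<partial>L) = 0"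
    by (simp add: LIMSEQ_const_iff)
  have "integrable L u"
    by (rule L.integrable_const_bound[where B = 1]) (auto simp: u_def infdist_nonneg)
  then have "AE t in L. u t = 0"
    using u0 by (subst (asm) integral_nonneg_eq_0_iff_AE) (auto simp: u_def infdist_nonneg)
  then have "AE t in L. t \<in> K"
    by eventually_elim (use in_closed_iff_infdist_zero[OF \<open>closed K\<close> ne] in \<open>auto simp: u_def min_def split: if_splits\<close>)
  then have "measure L K = 1"
    using \<open>closed K\<close> by (subst L.prob_eq_1) auto
  then show ?thesis using that r by auto
qed

text \<open>
  A strictly convex functional on distributions that is continuous for weak convergence. The normal
  distribution serves as a weight with positive density and total mass 1.
\<close>
definition energy :: "real measure \<Rightarrow> real" where
  "energy M = (\<integral>x. (cdf M x)\<^sup>2 \<partial>std_normal_distribution)"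

lemma borel_measurable_cdf:
  assumes "real_distribution M"
  shows "cdf M \<in> borel_measurable borel"
proof -
  interpret real_distribution M by fact
  show ?thesis by (intro borel_measurable_mono monoI cdf_nondecreasing)
qed

lemma real_distribution_cdf_bounds:
  assumes "real_distribution M" shows "0 \<le> cdf M x" "cdf M x \<le> 1"
proof -
  interpret real_distribution M by fact
  show "0 \<le> cdf M x" "cdf M x \<le> 1" by (rule cdf_nonneg, rule cdf_bounded_prob)
qed

lemma integrable_std_normal_bounded:
  fixes f :: "real \<Rightarrow> real"
  assumes "f \<in> borel_measurable borel" "\<And>x. \<bar>f x\<bar> \<le> B"
  shows "integrable std_normal_distribution f"
proof -
  interpret N: real_distribution std_normal_distribution by (rule real_dist_normal_dist)
  show ?thesis by (rule N.integrable_const_bound[where B = B]) (use assms in auto)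
qed

lemma energy_bounds:
  assumes "real_distribution M" shows "0 \<le> energy M" "energy M \<le> 1"
proof -
  interpret N: real_distribution std_normal_distribution by (rule real_dist_normal_dist)
  show "0 \<le> energy M" unfolding energy_def by simp
  have "energy M \<le> (\<integral>x. 1 \<partial>std_normal_distribution)"
    unfolding energy_def using real_distribution_cdf_bounds[OF assms] borel_measurable_cdf[OF assms]
    by (intro integral_mono integrable_std_normal_bounded[where B = 1])
      (auto simp: abs_le_square_iff power_le_one)
  then show "energy M \<le> 1" using N.prob_space by simp
qed

text \<open>
  Distribution functions converge off the countable set of discontinuities of the limit, which the
  normal distribution does not charge.
\<close>
lemma weak_conv_energy:
  assumes conv: "weak_conv_m M L" and M: "\<And>n. real_distribution (M n)" and L: "real_distribution L"
  shows "(\<lambda>n. energy (M n)) \<longlonglongrightarrow> energy L"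
proof -
  interpret N: real_distribution std_normal_distribution by (rule real_dist_normal_dist)
  interpret L: real_distribution L by fact
  have "countable {x. \<not> isCont (cdf L) x}"
    by (intro mono_ctble_discont monoI L.cdf_nondecreasing)
  then have "AE x in lborel. x \<notin> {x. \<not> isCont (cdf L) x}"
    by (intro AE_not_in countable_imp_null_set_lborel)
  then have cont: "AE x in std_normal_distribution. isCont (cdf L) x"
    by (subst AE_density) (auto elim!: eventually_mono)
  show ?thesis
    unfolding energy_def
  proof (rule integral_dominated_convergence[where w = "\<lambda>_. 1"])
    show "AE x in std_normal_distribution. (\<lambda>n. (cdf (M n) x)\<^sup>2) \<longlonglongrightarrow> (cdf L x)\<^sup>2"
      using cont conv unfolding weak_conv_m_def weak_conv_def
      by (auto intro!: tendsto_power elim!: eventually_mono)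
  qed (use borel_measurable_cdf M L real_distribution_cdf_bounds in \<open>auto simp: power_le_one\<close>)
qed

text \<open>
  Both distribution functions are right continuous, so agreement on a dense set suffices.
\<close>
lemma cdf_eq_of_AE_eq:
  assumes M: "real_distribution M" "real_distribution M'"
    and ae: "AE x in std_normal_distribution. cdf M x = cdf M' x"
  shows "M = M'"
proof (rule cdf_unique[OF M], rule ext)
  interpret M: real_distribution M by fact
  interpret M': real_distribution M' by fact
  fix a :: real
  have ae': "AE x in lborel. cdf M x = cdf M' x"
    using ae by (simp add: AE_density normal_density_pos)
  have ex: "\<exists>x. a < x \<and> x < b \<and> cdf M x = cdf M' x" if "a < b" for b
  proof (rule ccontr)
    assume "\<not> ?thesis"
    then have "AE x in lborel. x \<notin> {a<..<b}"
      using ae' by (auto elim!: eventually_mono)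
    then have "emeasure lborel {a<..<b} = 0"
      by (subst (asm) AE_iff_measurable[OF _ refl]) (auto simp: greaterThanLessThan_def greaterThan_def lessThan_def Int_def)
    then show False using that by simp
  qed
  have "\<exists>x. a < x \<and> x < a + 1 / real (Suc n) \<and> cdf M x = cdf M' x" for n
    by (rule ex) simp
  then obtain X where X: "\<And>n. a < X n" "\<And>n. X n < a + 1 / real (Suc n)" "\<And>n. cdf M (X n) = cdf M' (X n)"
    by metis
  have "X \<longlonglongrightarrow> a"
  proof (rule tendsto_sandwich)
    show "(\<lambda>n. a) \<longlonglongrightarrow> a" by simp
    show "(\<lambda>n. a + 1 / real (Suc n)) \<longlonglongrightarrow> a"
      using tendsto_add[OF tendsto_const lim_inverse_n'[THEN LIMSEQ_Suc]] by simp
  qed (use X in \<open>auto intro!: always_eventually less_imp_le\<close>)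
  then have lim: "filterlim X (at_right a) sequentially"
    using X(1) by (auto simp: filterlim_at intro!: always_eventually)
  have "(\<lambda>n. cdf M (X n)) \<longlonglongrightarrow> cdf M a" "(\<lambda>n. cdf M' (X n)) \<longlonglongrightarrow> cdf M' a"
    using M.cdf_is_right_cont[of a] M'.cdf_is_right_cont[of a] lim
    unfolding continuous_within by (auto intro: filterlim_compose)
  then show "cdf M a = cdf M' a"
    using X(3) LIMSEQ_unique by auto
qed

text \<open>
  Pointwise, \<open>(p a + (1 - p) b)\<^sup>2 = p a\<^sup>2 + (1 - p) b\<^sup>2 - p (1 - p) (a - b)\<^sup>2\<close>; integrating leaves no room
  for the last term.
\<close>
lemma energy_strictly_convex:
  assumes M: "real_distribution M" "real_distribution A" "real_distribution B"
    and p: "0 < p" "p < 1" and eq: "\<And>x. cdf M x = p * cdf A x + (1 - p) * cdf B x"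
    and le: "p * energy A + (1 - p) * energy B \<le> energy M"
  shows "A = B"
proof -
  interpret N: real_distribution std_normal_distribution by (rule real_dist_normal_dist)
  note [measurable] = borel_measurable_cdf[OF M(2)] borel_measurable_cdf[OF M(3)]
  note bnd = real_distribution_cdf_bounds[OF M(2)] real_distribution_cdf_bounds[OF M(3)]
  have iA: "integrable std_normal_distribution (\<lambda>x. (cdf A x)\<^sup>2)"
    using bnd by (intro integrable_std_normal_bounded[where B = 1]) (auto simp: power_le_one)
  have iB: "integrable std_normal_distribution (\<lambda>x. (cdf B x)\<^sup>2)"
    using bnd by (intro integrable_std_normal_bounded[where B = 1]) (auto simp: power_le_one)
  have "\<bar>(cdf A x - cdf B x)\<^sup>2\<bar> \<le> 1" for x
    using bnd(1,2)[of x] bnd(3,4)[of x] by (simp add: abs_square_le_1 abs_le_iff)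
  then have iD: "integrable std_normal_distribution (\<lambda>x. (cdf A x - cdf B x)\<^sup>2)"
    by (intro integrable_std_normal_bounded[where B = 1]) auto
  have "(cdf M x)\<^sup>2 = p * (cdf A x)\<^sup>2 + (1 - p) * (cdf B x)\<^sup>2 - p * (1 - p) * (cdf A x - cdf B x)\<^sup>2" for x
    unfolding eq by (simp add: power2_eq_square algebra_simps)
  then have "energy M = p * energy A + (1 - p) * energy B
      - p * (1 - p) * (\<integral>x. (cdf A x - cdf B x)\<^sup>2 \<partial>std_normal_distribution)"
    unfolding energy_def using iA iB iD by simp
  with le have "p * (1 - p) * (\<integral>x. (cdf A x - cdf B x)\<^sup>2 \<partial>std_normal_distribution) \<le> 0"
    by linarith
  then have "(\<integral>x. (cdf A x - cdf B x)\<^sup>2 \<partial>std_normal_distribution) \<le> 0"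
    using p by (simp add: mult_le_0_iff)
  moreover have "(\<integral>x. (cdf A x - cdf B x)\<^sup>2 \<partial>std_normal_distribution) \<ge> 0"
    by simp
  ultimately have "(\<integral>x. (cdf A x - cdf B x)\<^sup>2 \<partial>std_normal_distribution) = 0"
    by linarith
  then have "AE x in std_normal_distribution. (cdf A x - cdf B x)\<^sup>2 = 0"
    using integral_nonneg_eq_0_iff_AE[OF iD] by simp
  then have "AE x in std_normal_distribution. cdf A x = cdf B x"
    by (auto elim!: eventually_mono)
  then show ?thesis by (rule cdf_eq_of_AE_eq[OF M(2,3)])
qed

section \<open>Ergodic measures with a prescribed positive integral\<close>

text \<open>
  Indicators of closed sets are decreasing limits of continuous functions of the distance.
\<close>
lemma borel_measure_eqI_continuous:
  fixes M N :: "'y::metric_space measure"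
  assumes sets: "sets M = sets borel" "sets N = sets borel"
    and prob: "prob_space M" "prob_space N"
    and eq: "\<And>u. continuous_on UNIV u \<Longrightarrow> (\<And>y. 0 \<le> u y \<and> u y \<le> 1) \<Longrightarrow> (\<integral>y. u y \<partial>M) = (\<integral>y. (u y :: real) \<partial>N)"
  shows "M = N"
proof (rule measure_eqI_generator_eq[where E = "Collect closed" and \<Omega> = UNIV and A = "\<lambda>_. UNIV"])
  interpret M: prob_space M by fact
  interpret N: prob_space N by fact
  show "Int_stable (Collect closed :: 'y set set)"
    by (auto simp: Int_stable_def)
  show "sets M = sigma_sets UNIV (Collect closed)" "sets N = sigma_sets UNIV (Collect closed)"
    unfolding sets borel_eq_closed by simp_all
  fix C :: "'y set" assume "C \<in> Collect closed"
  then have "closed C" by simp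
  show "emeasure M C = emeasure N C"
  proof (cases "C = {}")
    case False
    define u :: "nat \<Rightarrow> 'y \<Rightarrow> real" where "u n y = max 0 (1 - real n * infdist y C)" for n y
    have cont: "continuous_on UNIV (u n)" for n
      unfolding u_def by (intro continuous_intros)
    have bnd: "0 \<le> u n y \<and> u n y \<le> 1" for n y
      by (auto simp: u_def infdist_nonneg)
    have lim: "(\<lambda>n. u n y) \<longlonglongrightarrow> indicator C y" for y
    proof (cases "y \<in> C")
      case True
      then show ?thesis by (simp add: u_def)
    next
      case out: False
      then have pos: "infdist y C > 0"
        using in_closed_iff_infdist_zero[OF \<open>closed C\<close> False, of y] infdist_nonneg[of y C] by auto
      obtain m where m: "1 / infdist y C < real m" using reals_Archimedean2 by blast
      have "u n y = 0" if "n \<ge> m" for n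
      proof -
        have "1 < real m * infdist y C" using m pos by (simp add: field_simps)
        also have "\<dots> \<le> real n * infdist y C" using that pos by (intro mult_right_mono) auto
        finally show ?thesis by (simp add: u_def)
      qed
      then show ?thesis
        using out by (auto intro!: tendsto_eventually eventually_sequentiallyI[of m])
    qed
    have conv: "(\<lambda>n. \<integral>y. u n y \<partial>D) \<longlonglongrightarrow> measure D C" if "sets D = sets borel" "prob_space D" for D
    proof -
      interpret D: prob_space D by fact
      note [measurable_cong] = \<open>sets D = sets borel\<close>
      have [measurable]: "u n \<in> borel_measurable borel" for n
        using cont by (rule borel_measurable_continuous_onI)
      have [measurable]: "C \<in> sets D" using that \<open>closed C\<close> by simp
      have "(\<lambda>n. \<integral>y. u n y \<partial>D) \<longlonglongrightarrow> (\<integral>y. indicator C y \<partial>D)"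
        by (rule integral_dominated_convergence[where w = "\<lambda>_. 1"])
          (use lim bnd in \<open>auto simp: abs_le_iff intro: order_trans[OF _ zero_le_one]\<close>)
      then show ?thesis by simp
    qed
    have "measure M C = measure N C"
      using conv[OF sets(1) prob(1)] conv[OF sets(2) prob(2)] eq[OF cont bnd] LIMSEQ_unique by auto
    then show ?thesis by (simp add: M.emeasure_eq_measure N.emeasure_eq_measure)
  qed simp
qed (use assms prob_space.emeasure_space_1 in \<open>auto simp: prob_space_def finite_measure.emeasure_finite\<close>)

lemma integral_uniform_measure:
  fixes w :: "'a \<Rightarrow> real"
  assumes "prob_space M" "A \<in> sets M" "measure M A > 0" "w \<in> borel_measurable M"
  shows "(\<integral>t. w t \<partial>uniform_measure M A) = (\<integral>t. indicator A t * w t \<partial>M) / measure M A"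
proof -
  interpret prob_space M by fact
  have "(\<lambda>x. indicator A x / emeasure M A) = (\<lambda>x. ennreal (indicator A x / measure M A))"
    using assms(3) by (auto simp: emeasure_eq_measure divide_ennreal[symmetric] ennreal_indicator)
  then have "(\<integral>t. w t \<partial>uniform_measure M A) = (\<integral>t. (indicator A t / measure M A) * w t \<partial>M)"
    unfolding uniform_measure_def using assms
    by (simp add: integral_density)
  also have "\<dots> = (\<integral>t. (indicator A t * w t) / measure M A \<partial>M)"
    by simp
  finally show ?thesis by simp
qed

definition empirical :: "'g set \<Rightarrow> ('g \<Rightarrow> real) \<Rightarrow> real measure" where
  "empirical E z = distr (measure_pmf (pmf_of_set E)) borel z"

lemma real_distribution_empirical: "real_distribution (empirical E z)"
  unfolding empirical_def real_distribution_def real_distribution_axioms_def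
  by (auto intro!: prob_space.prob_space_distr prob_space_measure_pmf)

lemma integral_empirical:
  assumes "finite E" "E \<noteq> {}" "w \<in> borel_measurable borel"
  shows "(\<integral>t. w t \<partial>empirical E z) = (\<Sum>h\<in>E. w (z h)) / (real (card E) :: real)"
  unfolding empirical_def using assms
  by (simp add: integral_distr integral_pmf_of_set)

lemma folner_average_shift:
  fixes F :: "nat \<Rightarrow> 'g::ab_group_add set" and w :: "'g \<Rightarrow> real"
  assumes F: "folner_sequence F" and w: "\<And>h. \<bar>w h\<bar> \<le> B"
  shows "(\<lambda>n. (\<Sum>h\<in>F n. w (g + h)) / real (card (F n)) - (\<Sum>h\<in>F n. w h) / real (card (F n))) \<longlonglongrightarrow> 0"
proof (rule Lim_null_comparison)
  have fin: "finite (F n)" "F n \<noteq> {}" for n using F unfolding folner_sequence_def by auto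
  let ?d = "\<lambda>n. real (card (sym_diff ((\<lambda>h. g + h) ` F n) (F n))) / real (card (F n))"
  show "(\<lambda>n. B * ?d n) \<longlonglongrightarrow> 0"
  proof -
    have "?d \<longlonglongrightarrow> 0" using F unfolding folner_sequence_def by blast
    then show ?thesis by (rule tendsto_mult_right_zero)
  qed
  show "\<forall>\<^sub>F n in sequentially. norm ((\<Sum>h\<in>F n. w (g + h)) / real (card (F n)) - (\<Sum>h\<in>F n. w h) / real (card (F n))) \<le> B * ?d n"
  proof (intro always_eventually allI)
    fix n
    let ?G = "(\<lambda>h. g + h) ` F n"
    have "(\<Sum>h\<in>F n. w (g + h)) = (\<Sum>h\<in>?G. w h)"
      by (subst sum.reindex) (auto simp: inj_on_def)
    also have "\<dots> = (\<Sum>h\<in>?G - F n. w h) + (\<Sum>h\<in>?G \<inter> F n. w h)"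
      using fin by (subst sum.Int_Diff[of _ _ "F n"]) auto
    finally have 1: "(\<Sum>h\<in>F n. w (g + h)) = (\<Sum>h\<in>?G - F n. w h) + (\<Sum>h\<in>?G \<inter> F n. w h)" .
    have 2: "(\<Sum>h\<in>F n. w h) = (\<Sum>h\<in>F n - ?G. w h) + (\<Sum>h\<in>?G \<inter> F n. w h)"
      using fin by (subst sum.Int_Diff[of _ _ ?G]) (auto simp: Int_commute)
    have le: "\<bar>\<Sum>h\<in>E. w h\<bar> \<le> B * real (card E)" for E
      using sum_norm_bound[of E w B] w by (simp add: mult.commute)
    have "\<bar>(\<Sum>h\<in>F n. w (g + h)) - (\<Sum>h\<in>F n. w h)\<bar> \<le> B * real (card (?G - F n)) + B * real (card (F n - ?G))"
      using le[of "?G - F n"] le[of "F n - ?G"] unfolding 1 2 by linarith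
    also have "\<dots> = B * real (card (sym_diff ?G (F n)))"
      using fin by (subst card_Un_disjoint) (auto simp: algebra_simps)
    finally have "\<bar>(\<Sum>h\<in>F n. w (g + h)) - (\<Sum>h\<in>F n. w h)\<bar> / real (card (F n)) \<le> B * real (card (sym_diff ?G (F n))) / real (card (F n))"
      by (rule divide_right_mono) simp
    then show "norm ((\<Sum>h\<in>F n. w (g + h)) / real (card (F n)) - (\<Sum>h\<in>F n. w h) / real (card (F n))) \<le> B * ?d n"
      by (simp add: diff_divide_distrib[symmetric])
  qed
qed

text \<open>
  The orbit averages of \<open>x\<close> along the Folner sequence accumulate at an invariant measure \<open>L0\<close> with
  \<open>\<integral> f dL0 \<ge> c\<close>, and some ergodic measure should do nearly as well. Instead of decomposing \<open>L0\<close>, maximise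
  \<open>\<integral> f + c/2 energy\<close> over all invariant distributions of the code. The energy lies between 0 and 1,
  so a maximiser \<open>L\<close> still satisfies \<open>\<integral> f dL \<ge> c/2\<close>. If an invariant set \<open>A\<close> had measure strictly
  between 0 and 1, \<open>L\<close> would be a convex combination of its conditionings on \<open>A\<close> and on the
  complement, both invariant; strict convexity of the energy would force them to coincide, which is
  absurd on \<open>A\<close>.
\<close>
theorem ergodic_measure_with_positive_integral:
  fixes S :: "'g::ab_group_add \<Rightarrow> 'y::metric_space \<Rightarrow> 'y" and f :: "'y \<Rightarrow> real"
  assumes Y: "compact Y" and inv: "\<And>g y. y \<in> Y \<Longrightarrow> S g y \<in> Y"
    and cont: "\<And>g. continuous_on UNIV (S g)"
    and act: "\<And>g h y. S (g + h) y = S g (S h y)"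
    and F: "folner_sequence F" and x: "x \<in> Y"
    and f: "continuous_on UNIV f" and "c > 0"
    and freq: "\<exists>\<^sub>F n in sequentially. c \<le> (\<Sum>h\<in>F n. f (S h x)) / real (card (F n))"
  obtains M where "sets M = sets borel" "prob_space M" "\<And>g. distr M borel (S g) = M"
    "measure M Y = 1" "(\<integral>y. f y \<partial>M) > 0"
    "\<forall>A\<in>sets borel. (\<forall>g. S g -` A \<inter> Y = A \<inter> Y) \<longrightarrow> measure M A = 0 \<or> measure M A = 1"
proof -
  have finF: "finite (F n)" "F n \<noteq> {}" for n
    using F unfolding folner_sequence_def by auto
  obtain K :: "real set" and q s y0 where K: "compact K" "continuous_on K q" and qY: "\<And>t. q t \<in> Y"
    and q0: "\<And>t. t \<notin> K \<Longrightarrow> q t = y0"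
    and s: "\<And>y. y \<in> Y \<Longrightarrow> s y \<in> K" "\<And>y. y \<in> Y \<Longrightarrow> q (s y) = y"
    using compact_metric_real_code[OF Y] x by (metis empty_iff)
  have "closed K" using K(1) by (rule compact_imp_closed)
  have wq: "(\<lambda>t. w (q t)) \<in> borel_measurable borel" if "continuous_on UNIV w" for w :: "'y \<Rightarrow> real"
    by (rule borel_measurable_continuous_code[OF \<open>closed K\<close> K(2) q0 qY])
      (use that continuous_on_subset in auto)
  have wK: "continuous_on K (\<lambda>t. w (q t))" if "continuous_on UNIV w" for w :: "'y \<Rightarrow> real"
    using that K(2) by (intro continuous_on_compose2[OF that K(2)]) auto
  have q [measurable]: "q \<in> borel \<rightarrow>\<^sub>M borel"
    using borel_measurable_continuous_code[OF \<open>closed K\<close> K(2) q0 qY, where w = "\<lambda>y. y"] by simp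
  have [measurable]: "S g \<in> borel \<rightarrow>\<^sub>M borel" for g
    using cont by (rule borel_measurable_continuous_onI)
  have fm [measurable]: "f \<in> borel_measurable borel"
    using f by (rule borel_measurable_continuous_onI)
  obtain B where B: "B > 0" "\<And>y. y \<in> Y \<Longrightarrow> \<bar>f y\<bar> \<le> B"
  proof -
    have "bounded (f ` Y)"
      using continuous_on_subset[OF f] Y by (intro compact_imp_bounded compact_continuous_image) auto
    then show ?thesis using that unfolding bounded_pos by auto
  qed
  define test where "test u \<longleftrightarrow> continuous_on UNIV u \<and> (\<forall>y. 0 \<le> u y \<and> u y \<le> (1::real))" for u :: "'y \<Rightarrow> real"
  have testS: "continuous_on UNIV (\<lambda>y. u (S g y))" if "test u" for u g
    using that cont unfolding test_def by (auto intro: continuous_on_compose2)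
  \<comment> \<open>The distributions of the code under which the coded point has an invariant law.\<close>
  define \<N> where "\<N> = {\<nu>. real_distribution \<nu> \<and> measure \<nu> K = 1 \<and>
      (\<forall>g u. test u \<longrightarrow> (\<integral>t. u (S g (q t)) \<partial>\<nu>) = (\<integral>t. u (q t) \<partial>\<nu>))}"
  have limq: "(\<lambda>n. \<integral>t. w (q t) \<partial>M n) \<longlonglongrightarrow> (\<integral>t. w (q t) \<partial>L)"
    if "\<And>n. real_distribution (M n)" "\<And>n. measure (M n) K = 1" "real_distribution L" "measure L K = 1"
      "weak_conv_m M L" "continuous_on UNIV w" for M L and w :: "'y \<Rightarrow> real"
    by (rule weak_conv_integral_continuous_on_support[OF that(5,1,2,3,4) K(1) wK[OF that(6)] wq[OF that(6)]])
  have \<N>_lim: "L \<in> \<N>"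
    if M: "\<And>n. real_distribution (M n)" "\<And>n. measure (M n) K = 1"
      and L: "real_distribution L" "measure L K = 1" "weak_conv_m M L"
      and asym: "\<And>g u. test u \<Longrightarrow> (\<lambda>n. (\<integral>t. u (S g (q t)) \<partial>M n) - (\<integral>t. u (q t) \<partial>M n)) \<longlonglongrightarrow> 0"
    for M L
  proof -
    have "(\<integral>t. u (S g (q t)) \<partial>L) = (\<integral>t. u (q t) \<partial>L)"
      if u: "test u" for g u
    proof -
      have "(\<lambda>n. (\<integral>t. u (S g (q t)) \<partial>M n) - (\<integral>t. u (q t) \<partial>M n))
          \<longlonglongrightarrow> (\<integral>t. u (S g (q t)) \<partial>L) - (\<integral>t. u (q t) \<partial>L)"
        using u by (intro tendsto_diff limq[OF M L] testS) (auto simp: test_def)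
      then show ?thesis using LIMSEQ_unique asym[OF u] by fastforce
    qed
    then show ?thesis using L unfolding \<N>_def by blast
  qed
  define H where "H \<nu> = (\<integral>t. f (q t) \<partial>\<nu>) + c / 2 * energy \<nu>" for \<nu>
  have H_lim: "(\<lambda>n. H (M n)) \<longlonglongrightarrow> H L"
    if "\<And>n. real_distribution (M n)" "\<And>n. measure (M n) K = 1" "real_distribution L" "measure L K = 1"
      "weak_conv_m M L" for M L
    unfolding H_def by (intro tendsto_intros limq[OF that f] weak_conv_energy[OF that(5,1,3)])
  \<comment> \<open>A weak limit of the empirical measures of the orbit is invariant by the Folner property.\<close>
  obtain L0 where L0: "L0 \<in> \<N>" "c \<le> (\<integral>t. f (q t) \<partial>L0)"
  proof -
    have "infinite {n. c \<le> (\<Sum>h\<in>F n. f (S h x)) / real (card (F n))}"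
      using freq by (simp add: frequently_cofinite[symmetric] cofinite_eq_sequentially)
    then obtain a :: "nat \<Rightarrow> nat" where a: "strict_mono a"
        "\<And>k. c \<le> (\<Sum>h\<in>F (a k). f (S h x)) / real (card (F (a k)))"
      using infinite_enumerate[of "{n. c \<le> (\<Sum>h\<in>F n. f (S h x)) / real (card (F n))}"] by auto
    define M where "M k = empirical (F (a k)) (\<lambda>h. s (S h x))" for k
    have M: "real_distribution (M k)" for k
      unfolding M_def by (rule real_distribution_empirical)
    have int: "(\<integral>t. w t \<partial>M k) = (\<Sum>h\<in>F (a k). w (s (S h x))) / real (card (F (a k)))"
      if "w \<in> borel_measurable borel" for w :: "real \<Rightarrow> real" and k
      unfolding M_def by (rule integral_empirical[OF finF that])
    have MK: "measure (M k) K = 1" for k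
    proof -
      interpret real_distribution "M k" by (rule M)
      have [measurable]: "K \<in> sets borel" using \<open>closed K\<close> by simp
      have "(\<integral>t. indicator K t \<partial>M k) = (1::real)"
        using finF s(1) inv x by (subst int) auto
      then show ?thesis using \<open>closed K\<close> by simp
    qed
    obtain r L where r: "strict_mono (r :: nat \<Rightarrow> nat)" and L: "real_distribution L" "measure L K = 1"
      "weak_conv_m (M \<circ> r) L"
      by (rule seq_compact_distributions[OF M MK K(1)])
    have Mr: "real_distribution ((M \<circ> r) n)" "measure ((M \<circ> r) n) K = 1" for n
      using M MK by auto
    have "L \<in> \<N>"
    proof (rule \<N>_lim[OF Mr L])
      fix g u assume u: "test u"
      have "(\<lambda>n. (\<Sum>h\<in>F n. u (S (g + h) x)) / real (card (F n)) - (\<Sum>h\<in>F n. u (S h x)) / real (card (F n))) \<longlonglongrightarrow> 0"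
        using u by (intro folner_average_shift[OF F, where B = 1 and w = "\<lambda>h. u (S h x)"])
          (auto simp: test_def abs_le_iff intro: order_trans[OF _ zero_le_one])
      from LIMSEQ_subseq_LIMSEQ[OF this strict_mono_o[OF a(1) r]]
      show "(\<lambda>n. (\<integral>t. u (S g (q t)) \<partial>(M \<circ> r) n) - (\<integral>t. u (q t) \<partial>(M \<circ> r) n)) \<longlonglongrightarrow> 0"
        using int[OF wq[OF testS[OF u]]] int[OF wq[of u]] u s(2) inv x
        by (simp add: o_def act test_def)
    qed
    moreover have "c \<le> (\<integral>t. f (q t) \<partial>(M \<circ> r) n)" for n
      using a(2)[of "r n"] int[OF wq[OF f]] s(2) inv x by simp
    then have "c \<le> (\<integral>t. f (q t) \<partial>L)"
      by (intro LIMSEQ_le_const[OF limq[OF Mr L f]]) auto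
    ultimately show ?thesis using that by blast
  qed
  have intf: "\<bar>\<integral>t. f (q t) \<partial>\<nu>\<bar> \<le> B" if "real_distribution \<nu>" for \<nu>
  proof -
    interpret real_distribution \<nu> by fact
    have int: "integrable \<nu> (\<lambda>t. f (q t))"
      by (rule integrable_const_bound[where B = B]) (use B qY wq[OF f] in auto)
    have "\<bar>\<integral>t. f (q t) \<partial>\<nu>\<bar> \<le> (\<integral>t. \<bar>f (q t)\<bar> \<partial>\<nu>)"
      by (rule integral_abs_bound)
    also have "\<dots> \<le> (\<integral>t. B \<partial>\<nu>)"
      using int B qY by (intro integral_mono integrable_abs) auto
    finally show ?thesis using prob_space by simp
  qed
  \<comment> \<open>A maximiser of \<open>H\<close> is a weak limit of a maximising sequence.\<close>
  have H_le: "H \<nu> \<le> B + c / 2" if "\<nu> \<in> \<N>" for \<nu>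
  proof -
    have "real_distribution \<nu>" using that by (simp add: \<N>_def)
    then have "c / 2 * energy \<nu> \<le> c / 2 * 1" "(\<integral>t. f (q t) \<partial>\<nu>) \<le> B"
      using energy_bounds(2) \<open>c > 0\<close> intf by (intro mult_left_mono, auto simp: abs_le_iff)
    then show ?thesis unfolding H_def by linarith
  qed
  obtain L where L: "L \<in> \<N>" and max: "\<And>\<nu>. \<nu> \<in> \<N> \<Longrightarrow> H \<nu> \<le> H L"
  proof -
    define m where "m = (SUP \<nu>\<in>\<N>. H \<nu>)"
    have bdd: "bdd_above (H ` \<N>)" using H_le by (auto intro!: bdd_aboveI2)
    have "\<exists>\<nu>\<in>\<N>. m - 1 / real (Suc n) < H \<nu>" for n
      using less_cSUP_iff[OF _ bdd, of "m - 1 / real (Suc n)"] L0(1) unfolding m_def by auto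
    then obtain M where MN: "\<And>n. M n \<in> \<N>" and Mm: "\<And>n. m - 1 / real (Suc n) < H (M n)"
      by metis
    have M: "real_distribution (M n)" "measure (M n) K = 1" for n using MN unfolding \<N>_def by auto
    obtain r L where r: "strict_mono (r :: nat \<Rightarrow> nat)" and L: "real_distribution L" "measure L K = 1"
      "weak_conv_m (M \<circ> r) L"
      by (rule seq_compact_distributions[OF M K(1)])
    have Mr: "real_distribution ((M \<circ> r) n)" "measure ((M \<circ> r) n) K = 1" for n
      using M by auto
    have "L \<in> \<N>"
    proof (rule \<N>_lim[OF Mr L])
      fix g u assume u: "test u"
      then show "(\<lambda>n. (\<integral>t. u (S g (q t)) \<partial>(M \<circ> r) n) - (\<integral>t. u (q t) \<partial>(M \<circ> r) n)) \<longlonglongrightarrow> 0"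
        using MN unfolding \<N>_def by simp
    qed
    moreover have "H \<nu> \<le> H L" if "\<nu> \<in> \<N>" for \<nu>
    proof -
      have "m \<le> H L"
      proof (rule LIMSEQ_le)
        show "(\<lambda>n. H ((M \<circ> r) n)) \<longlonglongrightarrow> H L" by (rule H_lim[OF Mr L])
        have "(\<lambda>n. m - 1 / real (Suc n)) \<longlonglongrightarrow> m - 0"
          by (intro tendsto_diff tendsto_const lim_inverse_n'[THEN LIMSEQ_Suc])
        from LIMSEQ_subseq_LIMSEQ[OF this r] show "(\<lambda>n. m - 1 / real (Suc (r n))) \<longlonglongrightarrow> m"
          by (simp add: o_def)
        show "\<exists>N. \<forall>n\<ge>N. m - 1 / real (Suc (r n)) \<le> H ((M \<circ> r) n)"
          using Mm less_imp_le by auto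
      qed
      moreover have "H \<nu> \<le> m" unfolding m_def by (rule cSUP_upper[OF that bdd])
      ultimately show ?thesis by linarith
    qed
    ultimately show ?thesis using that by blast
  qed
  have LD: "real_distribution L" and LK: "measure L K = 1" using L unfolding \<N>_def by auto
  interpret L: real_distribution L by (rule LD)
  define M where "M = distr L borel q"
  have setsM: "sets M = sets borel" unfolding M_def by simp
  have probM: "prob_space M" unfolding M_def by (rule L.prob_space_distr) simp
  interpret M: prob_space M by (rule probM)
  have invM: "distr M borel (S g) = M" for g
  proof (rule borel_measure_eqI_continuous)
    show "prob_space (distr M borel (S g))"
      using setsM by (intro M.prob_space_distr) (simp add: measurable_cong_sets[OF setsM refl])
    fix u :: "'y \<Rightarrow> real" assume u: "continuous_on UNIV u" "\<And>y. 0 \<le> u y \<and> u y \<le> 1"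
    have [measurable]: "u \<in> borel_measurable borel"
      using u(1) by (rule borel_measurable_continuous_onI)
    have "(\<integral>y. u y \<partial>distr M borel (S g)) = (\<integral>t. u (S g (q t)) \<partial>L)"
      unfolding M_def by (simp add: integral_distr distr_distr o_def)
    also have "\<dots> = (\<integral>t. u (q t) \<partial>L)"
      using L u unfolding \<N>_def test_def by blast
    finally show "(\<integral>y. u y \<partial>distr M borel (S g)) = (\<integral>y. u y \<partial>M)"
      unfolding M_def by (simp add: integral_distr)
  qed (use setsM probM in auto)
  have MY: "measure M Y = 1"
    using compact_imp_closed[OF Y] qY L.prob_space unfolding M_def
    by (simp add: measure_distr vimage_def)
  have Mf: "(\<integral>y. f y \<partial>M) > 0"
  proof -
    have "c \<le> H L0"
      unfolding H_def using L0 energy_bounds(1)[of L0] \<open>c > 0\<close>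
      by (auto simp: \<N>_def intro: add_increasing2)
    also have "\<dots> \<le> H L" by (rule max[OF L0(1)])
    also have "\<dots> \<le> (\<integral>t. f (q t) \<partial>L) + c / 2"
      unfolding H_def using energy_bounds(2)[OF LD] \<open>c > 0\<close> by simp
    finally show ?thesis unfolding M_def using \<open>c > 0\<close> by (simp add: integral_distr)
  qed
  \<comment> \<open>Conditioning on an invariant set does not lead out of \<open>\<N>\<close>.\<close>
  have cond: "uniform_measure L (q -` A) \<in> \<N>"
    if A: "A \<in> sets borel" "\<And>g. S g -` A \<inter> Y = A \<inter> Y" and pos: "measure L (q -` A) > 0" for A
  proof -
    have [measurable]: "A \<in> sets borel" by fact
    have qA [measurable]: "q -` A \<in> sets borel"
      using measurable_sets[OF q A(1)] by simp
    have "prob_space (uniform_measure L (q -` A))"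
      using pos by (intro prob_space_uniform_measure) (auto simp: L.emeasure_eq_measure)
    then have "real_distribution (uniform_measure L (q -` A))"
      by (auto simp: real_distribution_def real_distribution_axioms_def)
    moreover have "measure (uniform_measure L (q -` A)) K = 1"
    proof -
      have "measure L (q -` A \<inter> K) = measure L (q -` A)"
        using AE_supported[OF LD \<open>closed K\<close> LK] \<open>closed K\<close>
        by (intro L.finite_measure_eq_AE) auto
      then show ?thesis
        using pos \<open>closed K\<close> by (subst measure_uniform_measure) (auto simp: L.emeasure_eq_measure)
    qed
    moreover have "(\<integral>t. u (S g (q t)) \<partial>uniform_measure L (q -` A)) = (\<integral>t. u (q t) \<partial>uniform_measure L (q -` A))"
      if u: "test u" for g u
    proof -
      have [measurable]: "u \<in> borel_measurable borel"
        using u unfolding test_def by (auto intro: borel_measurable_continuous_onI)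
      have "S g (q t) \<in> A \<longleftrightarrow> q t \<in> A" for t
        using A(2)[of g] qY[of t] by blast
      then have "(\<integral>t. indicator (q -` A) t * u (S g (q t)) \<partial>L) = (\<integral>t. indicator A (S g (q t)) * u (S g (q t)) \<partial>L)"
        by (intro Bochner_Integration.integral_cong) (auto simp: indicator_def)
      also have "\<dots> = (\<integral>y. indicator A y * u y \<partial>distr M borel (S g))"
        unfolding M_def by (simp add: integral_distr distr_distr o_def)
      also have "\<dots> = (\<integral>t. indicator A (q t) * u (q t) \<partial>L)"
        unfolding invM by (simp add: M_def integral_distr)
      also have "\<dots> = (\<integral>t. indicator (q -` A) t * u (q t) \<partial>L)"
        by (intro Bochner_Integration.integral_cong) (auto simp: indicator_def)
      finally show ?thesis
        using pos by (simp add: integral_uniform_measure[OF L.prob_space_axioms])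
    qed
    ultimately show ?thesis unfolding \<N>_def by blast
  qed
  have erg: "measure M A = 0 \<or> measure M A = 1"
    if A: "A \<in> sets borel" "\<And>g. S g -` A \<inter> Y = A \<inter> Y" for A
  proof (rule ccontr)
    assume ne: "\<not> ?thesis"
    let ?A = "q -` A"
    have qA [measurable]: "?A \<in> sets borel"
      using measurable_sets[OF q A(1)] by simp
    define p where "p = measure L ?A"
    have "measure M A = p"
      unfolding M_def p_def using A(1) by (simp add: measure_distr)
    then have p: "0 < p" "p < 1"
      using ne M.prob_le_1[of A] by (auto simp: less_le)
    have "q -` (- A) = space L - ?A" by auto
    then have p': "measure L (q -` (- A)) = 1 - p"
      using L.prob_compl[of ?A] unfolding p_def by simp
    define P where "P = uniform_measure L ?A"
    define Q where "Q = uniform_measure L (q -` (- A))"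
    have PN: "P \<in> \<N>" unfolding P_def using A p by (intro cond) (auto simp: p_def)
    have QN: "Q \<in> \<N>" unfolding Q_def using A p p' by (intro cond) (auto simp: vimage_Compl)
    have PD: "real_distribution P" and QD: "real_distribution Q" using PN QN by (auto simp: \<N>_def)
    have qA' [measurable]: "q -` (- A) \<in> sets borel" by (simp add: vimage_Compl)
    have mP: "measure P X = measure L (?A \<inter> X) / p" if "X \<in> sets borel" for X
      unfolding P_def using that p by (subst measure_uniform_measure) (auto simp: L.emeasure_eq_measure p_def)
    have mQ: "measure Q X = measure L (q -` (- A) \<inter> X) / (1 - p)" if "X \<in> sets borel" for X
      unfolding Q_def using that p p' by (subst measure_uniform_measure) (auto simp: L.emeasure_eq_measure)
    have cdf: "cdf L x = p * cdf P x + (1 - p) * cdf Q x" for x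
    proof -
      have "measure L {..x} = measure L (?A \<inter> {..x}) + measure L (q -` (- A) \<inter> {..x})"
        by (subst L.finite_measure_Union[symmetric]) (auto intro!: arg_cong[where f = "measure L"])
      then show ?thesis unfolding cdf_def using mP mQ p by simp
    qed
    have intL: "(\<integral>t. f (q t) \<partial>L) = p * (\<integral>t. f (q t) \<partial>P) + (1 - p) * (\<integral>t. f (q t) \<partial>Q)"
    proof -
      have i: "integrable L (\<lambda>t. indicator X t * f (q t))" if [measurable]: "X \<in> sets borel" for X
        by (rule L.integrable_const_bound[where B = B])
          (use B qY in \<open>auto simp: indicator_def less_imp_le\<close>)
      have "(\<integral>t. f (q t) \<partial>L) = (\<integral>t. indicator ?A t * f (q t) + indicator (q -` (- A)) t * f (q t) \<partial>L)"
        by (intro Bochner_Integration.integral_cong) (auto simp: indicator_def)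
      also have "\<dots> = (\<integral>t. indicator ?A t * f (q t) \<partial>L) + (\<integral>t. indicator (q -` (- A)) t * f (q t) \<partial>L)"
        by (intro Bochner_Integration.integral_add i qA qA')
      finally show ?thesis
        unfolding P_def Q_def using p p'
        by (simp add: integral_uniform_measure[OF L.prob_space_axioms] p_def[symmetric])
    qed
    have "p * H P + (1 - p) * H Q \<le> p * H L + (1 - p) * H L"
      using p max[OF PN] max[OF QN] by (intro add_mono mult_left_mono) auto
    then have "c / 2 * (p * energy P + (1 - p) * energy Q) \<le> c / 2 * energy L"
      unfolding H_def intL by (simp add: algebra_simps add_divide_distrib diff_divide_distrib)
    then have "p * energy P + (1 - p) * energy Q \<le> energy L"
      using \<open>c > 0\<close> by simp
    then have "P = Q"
      by (rule energy_strictly_convex[OF LD PD QD p cdf])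
    moreover have "measure P ?A = 1" using mP[OF qA] p by (simp add: p_def)
    moreover have "measure Q ?A = 0" using mQ[OF qA] by (simp add: vimage_Compl)
    ultimately show False by simp
  qed
  show ?thesis by (rule that[OF setsM probM invM MY Mf]) (use erg in blast)
qed

section \<open>Proximity along Folner sequences\<close>

text \<open>
  If the times at which \<open>x\<close> and \<open>y\<close> are \<open>1/(k+1)\<close>-close had density at least \<open>e\<close> along infinitely many
  \<open>F n\<close> for every \<open>k\<close>, take those in \<open>F (a k)\<close> for a strictly increasing sequence \<open>a\<close>. Their union has
  upper density at least \<open>e\<close>, and all but finitely many of its elements bring \<open>x\<close> and \<open>y\<close> within any
  prescribed distance.
\<close>
lemma not_weakly_asymptotic_imp_rarely_close:
  assumes fin: "\<And>n. finite (F n)" and ne: "x \<noteq> y" and no: "\<not> weakly_asymptotic_pair F T x y" and "e > 0"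
  shows "\<exists>\<delta>>0. \<forall>\<^sub>F n in sequentially.
    real (card (F n \<inter> {g. dist (T g x) (T g y) < \<delta>})) / real (card (F n)) < e"
proof (rule ccontr)
  assume contr: "\<not> ?thesis"
  define D where "D k = {g. dist (T g x) (T g y) < 1 / real (Suc k)}" for k
  define ratio where "ratio A n = real (card (F n \<inter> A)) / real (card (F n))" for A n
  have freq: "\<exists>\<^sub>F n in sequentially. e \<le> ratio (D k) n" for k
  proof -
    have "1 / real (Suc k) > 0" by simp
    then have "\<not> (\<forall>\<^sub>F n in sequentially. ratio (D k) n < e)"
      using contr unfolding D_def ratio_def by blast
    then show ?thesis by (simp add: frequently_def not_le)
  qed
  have "\<exists>a. \<forall>k. e \<le> ratio (D k) (a k) \<and> a k < a (Suc k)"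
  proof (rule dependent_nat_choice)
    show "\<exists>n. e \<le> ratio (D 0) n"
      using freq[of 0] frequently_ex by blast
    fix n k
    have "\<exists>\<^sub>F m in sequentially. e \<le> ratio (D (Suc k)) m \<and> m > n"
      using frequently_eventually_frequently[OF freq[of "Suc k"] eventually_gt_at_top[of n]] .
    then show "\<exists>m. e \<le> ratio (D (Suc k)) m \<and> n < m"
      using frequently_ex by blast
  qed
  then obtain a where a: "\<And>k. e \<le> ratio (D k) (a k)" "\<And>k. a k < a (Suc k)" by blast
  have mono: "strict_mono a" using a(2) by (simp add: strict_mono_Suc_iff)
  define E where "E = (\<Union>k. F (a k) \<inter> D k)"
  have "ereal e \<le> limsup ((\<lambda>n. ereal (ratio E n)) \<circ> a)"
  proof (rule le_Limsup)
    show "\<forall>\<^sub>F k in sequentially. ereal e \<le> ((\<lambda>n. ereal (ratio E n)) \<circ> a) k"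
    proof (intro always_eventually allI)
      fix k
      have "card (F (a k) \<inter> D k) \<le> card (F (a k) \<inter> E)"
        using fin by (intro card_mono) (auto simp: E_def)
      then have "ratio (D k) (a k) \<le> ratio E (a k)"
        unfolding ratio_def by (intro divide_right_mono) auto
      then show "ereal e \<le> ((\<lambda>n. ereal (ratio E n)) \<circ> a) k"
        using a(1)[of k] by simp
    qed
  qed simp
  also have "\<dots> \<le> limsup (\<lambda>n. ereal (ratio E n))"
    by (rule limsup_subseq_mono[OF mono])
  finally have "ereal e \<le> upper_density F E"
    unfolding upper_density_def ratio_def .
  then have "upper_density F E > 0"
    using \<open>e > 0\<close> by (metis ereal_less(2) less_le_trans)
  moreover have "((\<lambda>g. dist (T g x) (T g y)) \<longlongrightarrow> 0) (inf cofinite (principal E))"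
    unfolding tendsto_iff
  proof (intro allI impI)
    fix r :: real assume "r > 0"
    obtain m where m: "1 / real (Suc m) < r" using \<open>r > 0\<close> by (metis nat_approx_posE)
    have "{g. \<not> (g \<in> E \<longrightarrow> dist (dist (T g x) (T g y)) 0 < r)} \<subseteq> (\<Union>k<m. F (a k))"
    proof
      fix g assume "g \<in> {g. \<not> (g \<in> E \<longrightarrow> dist (dist (T g x) (T g y)) 0 < r)}"
      then have g: "g \<in> E" "r \<le> dist (T g x) (T g y)" by auto
      then obtain k where k: "g \<in> F (a k)" "dist (T g x) (T g y) < 1 / real (Suc k)"
        unfolding E_def D_def by auto
      have "k < m"
      proof (rule ccontr)
        assume "\<not> k < m"
        then have "1 / real (Suc k) \<le> 1 / real (Suc m)" by (intro divide_left_mono) auto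
        then show False using g(2) k(2) m by linarith
      qed
      then show "g \<in> (\<Union>k<m. F (a k))" using k(1) by auto
    qed
    then have "finite {g. \<not> (g \<in> E \<longrightarrow> dist (dist (T g x) (T g y)) 0 < r)}"
      by (rule finite_subset) (use fin in auto)
    then show "\<forall>\<^sub>F g in inf cofinite (principal E). dist (dist (T g x) (T g y)) 0 < r"
      unfolding eventually_inf_principal eventually_cofinite .
  qed
  ultimately show False
    using no ne unfolding weakly_asymptotic_pair_def by blast
qed

text \<open>
  If each of finitely many factors is rarely small, then most of the time none of them is small.
\<close>
lemma average_prod_bounded_below:
  fixes \<phi> :: "'s \<Rightarrow> 'g \<Rightarrow> real" and F :: "nat \<Rightarrow> 'g set"
  assumes fin: "\<And>n. finite (F n)" "\<And>n. F n \<noteq> {}" and S: "finite S"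
    and nn: "\<And>s h. \<phi> s h \<ge> 0"
    and rare: "\<And>s e. s \<in> S \<Longrightarrow> e > 0 \<Longrightarrow> \<exists>\<delta>>0. \<forall>\<^sub>F n in sequentially.
      real (card (F n \<inter> {h. \<phi> s h < \<delta>})) / real (card (F n)) < e"
  obtains c where "c > 0"
    "\<forall>\<^sub>F n in sequentially. c \<le> (\<Sum>h\<in>F n. \<Prod>s\<in>S. \<phi> s h) / real (card (F n))"
proof -
  define e where "e = 1 / (2 * (real (card S) + 1))"
  have e: "e > 0" "real (card S) * e \<le> 1/2" by (auto simp: e_def field_simps)
  have "\<forall>s\<in>S. \<exists>\<delta>>0. \<forall>\<^sub>F n in sequentially. real (card (F n \<inter> {h. \<phi> s h < \<delta>})) / real (card (F n)) < e"
    using rare e(1) by blast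
  from bchoice[OF this] obtain \<delta> where "\<forall>s\<in>S. \<delta> s > 0 \<and>
      (\<forall>\<^sub>F n in sequentially. real (card (F n \<inter> {h. \<phi> s h < \<delta> s})) / real (card (F n)) < e)"
    by (rule exE)
  then have \<delta>: "\<And>s. s \<in> S \<Longrightarrow> \<delta> s > 0"
    "\<And>s. s \<in> S \<Longrightarrow> \<forall>\<^sub>F n in sequentially. real (card (F n \<inter> {h. \<phi> s h < \<delta> s})) / real (card (F n)) < e"
    by auto
  define c where "c = (\<Prod>s\<in>S. \<delta> s)"
  have "c > 0" unfolding c_def using \<delta>(1) by (intro prod_pos) auto
  have "\<forall>\<^sub>F n in sequentially. \<forall>s\<in>S. real (card (F n \<inter> {h. \<phi> s h < \<delta> s})) / real (card (F n)) < e"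
    using \<delta>(2) S by (intro eventually_ball_finite) auto
  then have "\<forall>\<^sub>F n in sequentially. c / 2 \<le> (\<Sum>h\<in>F n. \<Prod>s\<in>S. \<phi> s h) / real (card (F n))"
  proof eventually_elim
    case (elim n)
    let ?B = "\<Union>s\<in>S. F n \<inter> {h. \<phi> s h < \<delta> s}"
    have pos: "real (card (F n)) > 0" using fin by (simp add: card_gt_0_iff)
    have "real (card ?B) \<le> real (\<Sum>s\<in>S. card (F n \<inter> {h. \<phi> s h < \<delta> s}))"
      using card_UN_le[OF S, of "\<lambda>s. F n \<inter> {h. \<phi> s h < \<delta> s}"] by (rule of_nat_mono)
    also have "\<dots> = (\<Sum>s\<in>S. real (card (F n \<inter> {h. \<phi> s h < \<delta> s})))" by simp
    also have "\<dots> \<le> (\<Sum>s\<in>S. e * real (card (F n)))"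
      using elim pos by (intro sum_mono) (auto simp: divide_less_eq less_imp_le)
    also have "\<dots> = (real (card S) * e) * real (card (F n))" by simp
    also have "\<dots> \<le> 1/2 * real (card (F n))"
      using e(2) by (rule mult_right_mono) simp
    finally have "real (card (F n - ?B)) \<ge> real (card (F n)) / 2"
      using fin S by (subst card_Diff_subset) (auto intro!: card_mono simp: of_nat_diff)
    then have "c * (real (card (F n)) / 2) \<le> c * real (card (F n - ?B))"
      using \<open>c > 0\<close> by (intro mult_left_mono) auto
    also have "\<dots> = (\<Sum>h\<in>F n - ?B. c)" by simp
    also have "\<dots> \<le> (\<Sum>h\<in>F n - ?B. \<Prod>s\<in>S. \<phi> s h)"
      unfolding c_def
    proof (intro sum_mono prod_mono conjI)
      fix h s assume "h \<in> F n - ?B" "s \<in> S"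
      then show "0 \<le> \<delta> s" "\<delta> s \<le> \<phi> s h" using \<delta>(1)[of s] by auto
    qed
    also have "\<dots> \<le> (\<Sum>h\<in>F n. \<Prod>s\<in>S. \<phi> s h)"
      using fin nn by (intro sum_mono2 prod_nonneg) auto
    finally show ?case using pos by (simp add: field_simps)
  qed
  then show ?thesis using that[of "c / 2"] \<open>c > 0\<close> by simp
qed

section \<open>Consequences of minimality and mixing\<close>

lemma action_vimage_eq_image:
  assumes "continuous_action T"
  shows "T g -` A = T (- g) ` A"
proof -
  have inv: "T g (T (- g) x) = x" "T (- g) (T g x) = x" for x
    using assms unfolding continuous_action_def by (metis add.right_inverse, metis add.left_inverse)
  show ?thesis
  proof (intro set_eqI iffI)
    fix x assume "x \<in> T g -` A"
    then show "x \<in> T (- g) ` A" using inv(2)[of x] by (metis image_eqI vimageD)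
  qed (auto simp: inv)
qed

lemma measurable_action:
  assumes "continuous_action T" shows "T g \<in> borel \<rightarrow>\<^sub>M borel"
  using assms unfolding continuous_action_def by (intro borel_measurable_continuous_onI) auto

lemma invariant_prob_vimage:
  assumes "continuous_action T" "invariant_prob T \<mu>" "A \<in> sets borel"
  shows "measure \<mu> (T g -` A) = measure \<mu> A"
proof -
  have \<mu>: "sets \<mu> = sets borel" "distr \<mu> borel (T g) = \<mu>"
    using assms(2) unfolding invariant_prob_def by auto
  have "measure \<mu> A = measure (distr \<mu> borel (T g)) A" by (simp add: \<mu>(2))
  also have "\<dots> = measure \<mu> (T g -` A \<inter> space \<mu>)"
    using measurable_action[OF assms(1)] assms(3) measurable_cong_sets[OF \<mu>(1) refl]
    by (intro measure_distr) auto
  finally show ?thesis using sets_eq_imp_space_eq[OF \<mu>(1)] by simp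
qed

text \<open>
  By minimality the countably many translates of \<open>U\<close> cover the space, and they all have the same
  measure.
\<close>
lemma minimal_open_measure_pos:
  fixes T :: "'g::{countable, ab_group_add} \<Rightarrow> 'x::metric_space \<Rightarrow> 'x"
  assumes T: "continuous_action T" and \<mu>: "invariant_prob T \<mu>" and min: "minimal_action T"
    and U: "open U" "U \<noteq> {}"
  shows "measure \<mu> U > 0"
proof (rule ccontr)
  interpret prob_space \<mu> using \<mu> unfolding invariant_prob_def by blast
  have sets: "sets \<mu> = sets borel" using \<mu> unfolding invariant_prob_def by blast
  have sp: "space \<mu> = UNIV" using sets_eq_imp_space_eq[OF sets] by simp
  assume "\<not> measure \<mu> U > 0"
  then have zero: "measure \<mu> (T g -` U) = 0" for g
    using invariant_prob_vimage[OF T \<mu>, of U g] U measure_nonneg[of \<mu> U] by simp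
  have meas: "T g -` U \<in> sets \<mu>" for g
    using measurable_sets[OF measurable_action[OF T], of U g] U(1) by (simp add: sets)
  have "(\<Union>g. T g -` U) = UNIV"
  proof -
    have "\<exists>g. T g x \<in> U" for x
    proof -
      have "closure (orbit_of T x) = UNIV" using min unfolding minimal_action_def by blast
      then have "U \<inter> orbit_of T x \<noteq> {}"
        using U open_Int_closure_eq_empty[of U "orbit_of T x"] by auto
      then show ?thesis unfolding orbit_of_def by auto
    qed
    then show ?thesis by auto
  qed
  moreover have "(\<Union>g. T g -` U) \<in> null_sets \<mu>"
    using zero meas by (intro null_sets_UN' null_setsI) (auto simp: emeasure_eq_measure)
  then have "emeasure \<mu> (\<Union>g. T g -` U) = 0" by (rule null_setsD1)
  ultimately show False using emeasure_space_1 sp by simp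
qed

text \<open>
  Along the mixing filter the measures converge to a positive product. Phrased with a finite set \<open>E\<close>
  of forbidden differences, eventual positivity applies directly to the shifts \<open>g\<close> of a single joining.
\<close>
lemma mixing_block_positive:
  assumes T: "continuous_action T" and \<mu>: "invariant_prob T \<mu>" and mix: "mixing_all_orders T \<mu>"
    and J: "finite J" "J \<noteq> {}" and U: "\<And>i. i \<in> J \<Longrightarrow> U i \<in> sets borel" "\<And>i. i \<in> J \<Longrightarrow> measure \<mu> (U i) > 0"
  shows "\<exists>E. finite E \<and> (\<forall>g :: nat \<Rightarrow> 'g :: ab_group_add. (\<forall>i\<in>J. \<forall>j\<in>J. i \<noteq> j \<longrightarrow> g i - g j \<notin> E) \<longrightarrow>
    measure \<mu> (\<Inter>i\<in>J. T (g i) -` U i) > 0)"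
proof (cases "card J = 1")
  case True
  then obtain i where "J = {i}" by (meson card_1_singletonE)
  then show ?thesis
    using invariant_prob_vimage[OF T \<mu> U(1)] U(2) by (intro exI[of _ "{}"]) auto
next
  case False
  \<comment> \<open>Number the elements of \<open>J\<close> by \<open>0, \<dots>, m\<close>; mixing speaks of at least two sets, hence \<open>m \<ge> 1\<close>.\<close>
  define m where "m = card J - 1"
  have m: "card J = Suc m" "m \<ge> 1"
    using False J card_gt_0_iff[of J] by (auto simp: m_def)
  obtain e where "bij_betw e {0..<card J} J"
    using ex_bij_betw_nat_finite[OF J(1)] by blast
  then have e: "bij_betw e {..m} J"
    using m(1) by (simp add: atLeast0LessThan lessThan_Suc_atMost)
  have eJ: "e k \<in> J" if "k \<le> m" for k using e that by (auto dest: bij_betwE)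
  let ?I = "{(i, j). i \<le> m \<and> j \<le> m \<and> i \<noteq> j}"
  have finI: "finite ?I"
    by (rule finite_subset[of _ "{..m} \<times> {..m}"]) auto
  let ?A = "\<lambda>k. U (e k)"
  have "((\<lambda>g. measure \<mu> (\<Inter>i\<le>m. T (g i) ` ?A i)) \<longlongrightarrow> (\<Prod>i\<le>m. measure \<mu> (?A i)))
          (INF (i, j) \<in> ?I. filtercomap (\<lambda>g. g j - g i) cofinite)"
    using mix m(2) U(1) eJ unfolding mixing_all_orders_def by auto
  moreover have "(\<Prod>i\<le>m. measure \<mu> (?A i)) > 0"
    using U(2) eJ by (intro prod_pos) auto
  ultimately have "\<forall>\<^sub>F g in (INF p \<in> ?I. filtercomap (\<lambda>g. g (snd p) - g (fst p)) cofinite).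
      measure \<mu> (\<Inter>i\<le>m. T (g i) ` ?A i) > 0"
    using order_tendstoD(1) by (fastforce simp: case_prod_unfold)
  then obtain Q where Q: "\<And>p. p \<in> ?I \<Longrightarrow> eventually (Q p) (filtercomap (\<lambda>g. g (snd p) - g (fst p)) cofinite)"
      "\<And>g. (\<And>p. p \<in> ?I \<Longrightarrow> Q p g) \<Longrightarrow> measure \<mu> (\<Inter>i\<le>m. T (g i) ` ?A i) > 0"
    unfolding eventually_INF_finite[OF finI] by blast
  have "\<forall>p\<in>?I. \<exists>E. finite E \<and> (\<forall>g. g (snd p) - g (fst p) \<notin> E \<longrightarrow> Q p g)"
  proof
    fix p assume "p \<in> ?I"
    then obtain R where R: "eventually R cofinite" "\<And>g. R (g (snd p) - g (fst p)) \<Longrightarrow> Q p g"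
      using Q(1) unfolding eventually_filtercomap by blast
    then show "\<exists>E. finite E \<and> (\<forall>g. g (snd p) - g (fst p) \<notin> E \<longrightarrow> Q p g)"
      by (intro exI[of _ "{h. \<not> R h}"]) (auto simp: eventually_cofinite)
  qed
  from bchoice[OF this] obtain E where
      "\<forall>p\<in>?I. finite (E p) \<and> (\<forall>g. g (snd p) - g (fst p) \<notin> E p \<longrightarrow> Q p g)"
    by (rule exE)
  then have E: "\<And>p. p \<in> ?I \<Longrightarrow> finite (E p)"
      "\<And>p g. p \<in> ?I \<Longrightarrow> g (snd p) - g (fst p) \<notin> E p \<Longrightarrow> Q p g"
    by auto
  show ?thesis
  proof (intro exI[of _ "\<Union>p\<in>?I. E p"] conjI allI impI)
    show "finite (\<Union>p\<in>?I. E p)" by (intro finite_UN_I finI E(1))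
    fix g :: "nat \<Rightarrow> 'g" assume g: "\<forall>i\<in>J. \<forall>j\<in>J. i \<noteq> j \<longrightarrow> g i - g j \<notin> (\<Union>p\<in>?I. E p)"
    define g' where "g' k = - g (e k)" for k
    have "Q p g'" if p: "p \<in> ?I" for p
    proof (rule E(2)[OF p])
      obtain i j where ij: "p = (i, j)" "i \<le> m" "j \<le> m" "i \<noteq> j" using p by auto
      have "e i \<noteq> e j" using ij e by (auto simp: bij_betw_def inj_on_def)
      then have "g (e i) - g (e j) \<notin> E p" using g eJ ij p by blast
      then show "g' (snd p) - g' (fst p) \<notin> E p" by (simp add: g'_def ij)
    qed
    then have "measure \<mu> (\<Inter>i\<le>m. T (g' i) ` ?A i) > 0" by (rule Q(2))
    also have "(\<Inter>i\<le>m. T (g' i) ` ?A i) = (\<Inter>i\<le>m. T (g (e i)) -` U (e i))"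
      by (simp add: g'_def action_vimage_eq_image[OF T])
    also have "\<dots> = (\<Inter>i\<in>e ` {..m}. T (g i) -` U i)" by simp
    also have "e ` {..m} = J" using e by (simp add: bij_betw_def)
    finally show "measure \<mu> (\<Inter>i\<in>J. T (g i) -` U i) > 0" .
  qed
qed

text \<open>
  There are finitely many blocks \<open>J\<close>, so one set \<open>E\<close> serves them all.
\<close>
lemma mixing_blocks_positive:
  fixes T :: "'g::ab_group_add \<Rightarrow> 'x::metric_space \<Rightarrow> 'x" and U :: "nat \<Rightarrow> 'x set" and N :: nat
  assumes T: "continuous_action T" and \<mu>: "invariant_prob T \<mu>" and mix: "mixing_all_orders T \<mu>"
    and U: "\<And>i. i < N \<Longrightarrow> U i \<in> sets borel" "\<And>i. i < N \<Longrightarrow> measure \<mu> (U i) > 0"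
  obtains E :: "'g set" where "finite E"
    "\<And>J g. J \<subseteq> {..<N} \<Longrightarrow> J \<noteq> {} \<Longrightarrow> (\<And>i j. i \<in> J \<Longrightarrow> j \<in> J \<Longrightarrow> i \<noteq> j \<Longrightarrow> g i - g j \<notin> E) \<Longrightarrow>
      measure \<mu> (\<Inter>i\<in>J. T (g i) -` U i) > 0"
proof -
  have "\<forall>J\<in>Pow {..<N} - {{}}. \<exists>E. finite E \<and> (\<forall>g :: nat \<Rightarrow> 'g.
    (\<forall>i\<in>J. \<forall>j\<in>J. i \<noteq> j \<longrightarrow> g i - g j \<notin> E) \<longrightarrow> measure \<mu> (\<Inter>i\<in>J. T (g i) -` U i) > 0)"
    using U by (intro ballI mixing_block_positive[OF T \<mu> mix]) (auto intro: finite_subset)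
  from bchoice[OF this] obtain E where E: "\<forall>J\<in>Pow {..<N} - {{}}. finite (E J) \<and> (\<forall>g :: nat \<Rightarrow> 'g.
    (\<forall>i\<in>J. \<forall>j\<in>J. i \<noteq> j \<longrightarrow> g i - g j \<notin> E J) \<longrightarrow> measure \<mu> (\<Inter>i\<in>J. T (g i) -` U i) > 0)"
    by (rule exE)
  show ?thesis
  proof (rule that[of "\<Union>J\<in>Pow {..<N} - {{}}. E J"])
    show "finite (\<Union>J\<in>Pow {..<N} - {{}}. E J)" using E by (intro finite_UN_I) auto
    fix J and g :: "nat \<Rightarrow> 'g" assume J: "J \<subseteq> {..<N}" "J \<noteq> {}"
      and g: "\<And>i j. i \<in> J \<Longrightarrow> j \<in> J \<Longrightarrow> i \<noteq> j \<Longrightarrow> g i - g j \<notin> (\<Union>J\<in>Pow {..<N} - {{}}. E J)"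
    have JP: "J \<in> Pow {..<N} - {{}}" using J by simp
    then have "\<forall>i\<in>J. \<forall>j\<in>J. i \<noteq> j \<longrightarrow> g i - g j \<notin> E J"
      using g by (meson UN_I)
    then show "measure \<mu> (\<Inter>i\<in>J. T (g i) -` U i) > 0" using bspec[OF E JP] by simp
  qed
qed

section \<open>Trivial joinings\<close>

lemma compact_dense_sequence:
  assumes "compact (UNIV :: 'x::metric_space set)"
  obtains d :: "nat \<Rightarrow> 'x::metric_space" where "\<And>x e. e > 0 \<Longrightarrow> \<exists>k. dist x (d k) < e"
proof -
  have "\<exists>k. finite k \<and> (UNIV :: 'x set) \<subseteq> (\<Union>c\<in>k. ball c (1 / real (Suc n)))" for n
    using assms unfolding compact_eq_totally_bounded by simp
  then obtain net :: "nat \<Rightarrow> 'x set" where net: "\<And>n. finite (net n)"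
      "\<And>n. UNIV \<subseteq> (\<Union>c\<in>net n. ball c (1 / real (Suc n)))"
    by metis
  let ?D = "\<Union>n. net n"
  have "countable ?D" using net(1) by (auto intro: countable_finite)
  moreover have "?D \<noteq> {}"
    using net(2)[of 0] by fastforce
  ultimately obtain d :: "nat \<Rightarrow> 'x" where d: "range d = ?D"
    by (metis range_from_nat_into)
  show ?thesis
  proof (rule that[of d])
    fix x :: 'x and e :: real assume "e > 0"
    then obtain n where n: "1 / real (Suc n) < e" by (metis nat_approx_posE)
    obtain c where c: "c \<in> net n" "dist c x < 1 / real (Suc n)"
      using net(2)[of n] by fastforce
    then have "c \<in> range d" unfolding d by blast
    then obtain k where "c = d k" by blast
    then have "dist x (d k) < e" using c(2) n by (simp add: dist_commute)
    then show "\<exists>k. dist x (d k) < e" ..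
  qed
qed

text \<open>
  Two points are equal iff they have the same distances to a dense sequence, which turns the
  coincidence of \<open>a\<close> and \<open>b\<close> into countably many conditions on measurable real functions.
\<close>
lemma coincidence_set_measurable:
  fixes a b :: "'a \<Rightarrow> 'x::metric_space"
  assumes X: "compact (UNIV :: 'x set)" and a: "a \<in> M \<rightarrow>\<^sub>M borel" and b: "b \<in> M \<rightarrow>\<^sub>M borel"
  shows "{y \<in> space M. a y = b y} \<in> sets M"
proof -
  obtain d :: "nat \<Rightarrow> 'x" where d: "\<And>x e. e > 0 \<Longrightarrow> \<exists>k. dist x (d k) < e"
    using compact_dense_sequence[OF X] by blast
  have "u = v" if eq: "\<And>k. dist u (d k) = dist v (d k)" for u v :: 'x
  proof (rule ccontr)
    assume "u \<noteq> v"
    then obtain k where "dist u (d k) < dist u v / 2" using d[of "dist u v / 2" u] by auto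
    then show False using eq[of k] dist_triangle_half_r[of "d k" u "dist u v" v]
      by (simp add: dist_commute)
  qed
  then have "{y \<in> space M. a y = b y} = {y \<in> space M. \<forall>k. dist (a y) (d k) = dist (b y) (d k)}"
    by auto
  also have "\<dots> \<in> sets M"
  proof -
    have "(\<lambda>x. dist x c) \<in> borel \<rightarrow>\<^sub>M borel" for c :: 'x
      by (intro borel_measurable_continuous_onI continuous_intros)
    then have [measurable]: "(\<lambda>y. dist (a y) c) \<in> M \<rightarrow>\<^sub>M borel" "(\<lambda>y. dist (b y) c) \<in> M \<rightarrow>\<^sub>M borel" for c
      using measurable_compose[OF a] measurable_compose[OF b] by blast+
    show ?thesis by measurable
  qed
  finally show ?thesis .
qed

lemma off_diagonal_joining_eq:
  assumes T: "\<And>g. T g \<in> borel \<rightarrow>\<^sub>M borel" and sets: "sets \<mu> = sets borel"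
  shows "off_diagonal_joining T \<mu> J g = distr \<mu> (\<Pi>\<^sub>M i\<in>J. borel) (\<lambda>z. \<lambda>i\<in>J. T (g i) z)"
proof -
  have [measurable_cong]: "sets \<mu> = sets borel" by (rule sets)
  have [measurable]: "T g \<in> borel \<rightarrow>\<^sub>M borel" for g by (rule T)
  show ?thesis
    unfolding off_diagonal_joining_def diagonal_joining_def
    by (subst distr_distr) (measurable, auto intro!: arg_cong[where f = "distr \<mu> _"] simp: o_def restrict_def fun_eq_iff)
qed

lemma off_diagonal_measurable:
  assumes T: "\<And>g. T g \<in> borel \<rightarrow>\<^sub>M borel" and sets: "sets \<mu> = sets borel"
  shows "(\<lambda>z. \<lambda>i\<in>J. T (g i) z) \<in> \<mu> \<rightarrow>\<^sub>M (\<Pi>\<^sub>M i\<in>J. borel)"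
proof -
  have [measurable_cong]: "sets \<mu> = sets borel" by (rule sets)
  have [measurable]: "T g \<in> borel \<rightarrow>\<^sub>M borel" for g by (rule T)
  show ?thesis by measurable
qed

lemma prob_space_off_diagonal_joining:
  assumes T: "\<And>g. T g \<in> borel \<rightarrow>\<^sub>M borel" and \<mu>: "sets \<mu> = sets borel" "prob_space \<mu>"
  shows "prob_space (off_diagonal_joining T \<mu> J g)"
  unfolding off_diagonal_joining_eq[of T, OF T \<mu>(1)]
  by (intro prob_space.prob_space_distr \<mu>(2) off_diagonal_measurable T \<mu>(1))

lemma emeasure_off_diagonal_joining:
  assumes T: "\<And>g. T g \<in> borel \<rightarrow>\<^sub>M borel" and sets: "sets \<mu> = sets borel"
    and J: "finite J" "J \<noteq> {}" and U: "\<And>i. i \<in> J \<Longrightarrow> U i \<in> sets borel"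
  shows "emeasure (off_diagonal_joining T \<mu> J g) (\<Pi>\<^sub>E i\<in>J. U i) = emeasure \<mu> (\<Inter>i\<in>J. T (g i) -` U i)"
proof -
  have sp: "space \<mu> = UNIV" using sets_eq_imp_space_eq[OF sets] by simp
  have "(\<Pi>\<^sub>E i\<in>J. U i) \<in> sets (\<Pi>\<^sub>M i\<in>J. borel)"
    using J U by (intro sets_PiM_I_finite) auto
  moreover have "(\<lambda>z. \<lambda>i\<in>J. T (g i) z) -` (\<Pi>\<^sub>E i\<in>J. U i) \<inter> space \<mu> = (\<Inter>i\<in>J. T (g i) -` U i)"
    using J(2) by (auto simp: sp PiE_iff)
  ultimately show ?thesis
    unfolding off_diagonal_joining_eq[of T, OF T sets]
    by (subst emeasure_distr[OF off_diagonal_measurable[of T, OF T sets]]) simp_all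
qed

lemma AE_off_diagonal_joining:
  fixes T :: "'g::ab_group_add \<Rightarrow> 'x::metric_space \<Rightarrow> 'x"
  assumes X: "compact (UNIV :: 'x set)" and act: "continuous_action T"
    and sets: "sets \<mu> = sets borel" and ij: "i \<in> J" "j \<in> J"
  shows "AE y in off_diagonal_joining T \<mu> J g. y i = T (g i - g j) (y j)"
proof -
  have T [measurable]: "T h \<in> borel \<rightarrow>\<^sub>M borel" for h by (rule measurable_action[OF act])
  have eq: "T (g i - g j) (T (g j) z) = T (g i) z" for z
    using act unfolding continuous_action_def by (metis diff_add_cancel)
  have "{y \<in> space (\<Pi>\<^sub>M i\<in>J. borel). y i = T (g i - g j) (y j)} \<in> sets (\<Pi>\<^sub>M i\<in>J. borel)"
    using ij by (intro coincidence_set_measurable[OF X]) measurable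
  then show ?thesis
    unfolding off_diagonal_joining_eq[of T, OF T sets]
    by (subst AE_distr_iff[OF off_diagonal_measurable[of T, OF T sets]]) (use ij eq in auto)
qed

text \<open>
  A trivial joining, with labelling \<open>b\<close> and shifts \<open>g\<close>, taken apart into its blocks.
\<close>
locale off_diagonal_product =
  fixes T :: "'g::ab_group_add \<Rightarrow> 'x::metric_space \<Rightarrow> 'x" and \<mu> :: "'x measure"
    and N :: nat and b :: "nat \<Rightarrow> nat" and g :: "nat \<Rightarrow> 'g"
  assumes X: "compact (UNIV :: 'x set)" and act: "continuous_action T"
    and sets_\<mu>: "sets \<mu> = sets borel" and prob_\<mu>: "prob_space \<mu>"
begin

lemma T [measurable]: "T h \<in> borel \<rightarrow>\<^sub>M borel"
  by (rule measurable_action[OF act])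

definition "block k = {i. i < N \<and> b i = k}"
definition "factor k = off_diagonal_joining T \<mu> (block k) g"
definition "glue = (\<lambda>w::nat \<Rightarrow> nat \<Rightarrow> 'x. \<lambda>i\<in>{..<N}. w (b i) i)"
definition "joining = distr (\<Pi>\<^sub>M k\<in>b ` {..<N}. factor k) (\<Pi>\<^sub>M i\<in>{..<N}. borel) glue"

lemma block: "finite (block k)" "k \<in> b ` {..<N} \<Longrightarrow> block k \<noteq> {}"
  by (auto simp: block_def)

lemma sets_factor [measurable_cong]: "sets (factor k) = sets (\<Pi>\<^sub>M i\<in>block k. borel)"
  unfolding factor_def off_diagonal_joining_def by simp

lemma prob_space_factor: "prob_space (factor k)"
  unfolding factor_def by (rule prob_space_off_diagonal_joining[of T, OF T sets_\<mu> prob_\<mu>])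

lemma glue_measurable: "glue \<in> (\<Pi>\<^sub>M k\<in>b ` {..<N}. factor k) \<rightarrow>\<^sub>M (\<Pi>\<^sub>M i\<in>{..<N}. borel)"
  unfolding glue_def
proof (rule measurable_restrict)
  fix i assume i: "i \<in> {..<N}"
  have "(\<lambda>w. w (b i)) \<in> (\<Pi>\<^sub>M k\<in>b ` {..<N}. factor k) \<rightarrow>\<^sub>M factor (b i)"
    using i by (intro measurable_component_singleton) auto
  moreover have "(\<lambda>y. y i) \<in> factor (b i) \<rightarrow>\<^sub>M borel"
    using i measurable_component_singleton[of i "block (b i)" "\<lambda>_. borel"]
    by (simp add: measurable_cong_sets[OF sets_factor refl] block_def)
  ultimately show "(\<lambda>w. w (b i) i) \<in> (\<Pi>\<^sub>M k\<in>b ` {..<N}. factor k) \<rightarrow>\<^sub>M borel"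
    by (rule measurable_compose)
qed

lemma emeasure_joining:
  assumes U: "\<And>i. i < N \<Longrightarrow> U i \<in> sets borel"
  shows "emeasure joining (\<Pi>\<^sub>E i\<in>{..<N}. U i) =
    (\<Prod>k\<in>b ` {..<N}. emeasure \<mu> (\<Inter>i\<in>block k. T (g i) -` U i))"
proof -
  interpret P: product_sigma_finite factor
    by (intro product_sigma_finite.intro) (simp add: prob_space_factor prob_space_imp_sigma_finite)
  have Ublock: "(\<Pi>\<^sub>E i\<in>block k. U i) \<in> sets (factor k)" for k
    unfolding sets_factor using block U by (intro sets_PiM_I_finite) (auto simp: block_def)
  have spf: "space (factor k) = (\<Pi>\<^sub>E i\<in>block k. UNIV)" for k
    using sets_eq_imp_space_eq[OF sets_factor[of k]] by (simp add: space_PiM)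
  have "(\<Pi>\<^sub>E i\<in>{..<N}. U i) \<in> sets (\<Pi>\<^sub>M i\<in>{..<N}. borel)"
    using U by (intro sets_PiM_I_finite) auto
  then have "emeasure joining (\<Pi>\<^sub>E i\<in>{..<N}. U i) =
      emeasure (\<Pi>\<^sub>M k\<in>b ` {..<N}. factor k)
        (glue -` (\<Pi>\<^sub>E i\<in>{..<N}. U i) \<inter> space (\<Pi>\<^sub>M k\<in>b ` {..<N}. factor k))"
    unfolding joining_def by (rule emeasure_distr[OF glue_measurable])
  also have "glue -` (\<Pi>\<^sub>E i\<in>{..<N}. U i) \<inter> space (\<Pi>\<^sub>M k\<in>b ` {..<N}. factor k) =
      (\<Pi>\<^sub>E k\<in>b ` {..<N}. \<Pi>\<^sub>E i\<in>block k. U i)"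
    by (auto simp: space_PiM spf glue_def PiE_iff block_def) (metis lessThan_iff)
  also have "emeasure (\<Pi>\<^sub>M k\<in>b ` {..<N}. factor k) \<dots> =
      (\<Prod>k\<in>b ` {..<N}. emeasure (factor k) (\<Pi>\<^sub>E i\<in>block k. U i))"
    using Ublock by (intro P.emeasure_PiM) auto
  also have "\<dots> = (\<Prod>k\<in>b ` {..<N}. emeasure \<mu> (\<Inter>i\<in>block k. T (g i) -` U i))"
    unfolding factor_def using block U
    by (intro prod.cong refl emeasure_off_diagonal_joining T sets_\<mu>) (auto simp: block_def)
  finally show ?thesis .
qed

lemma AE_joining:
  assumes ij: "i < N" "j < N" "b i = b j"
  shows "AE y in joining. y i = T (g i - g j) (y j)"
proof -
  have "AE y in factor (b i). y i = T (g i - g j) (y j)"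
    unfolding factor_def using ij by (intro AE_off_diagonal_joining X act sets_\<mu>) (auto simp: block_def)
  then have "AE w in (\<Pi>\<^sub>M k\<in>b ` {..<N}. factor k). w (b i) i = T (g i - g j) (w (b i) j)"
    using ij by (intro AE_PiM_component[where i = "b i"] prob_space_factor) auto
  moreover have "{y \<in> space (\<Pi>\<^sub>M i\<in>{..<N}. borel). y i = T (g i - g j) (y j)} \<in> sets (\<Pi>\<^sub>M i\<in>{..<N}. borel)"
    using ij by (intro coincidence_set_measurable[OF X]) measurable
  ultimately show ?thesis
    unfolding joining_def by (subst AE_distr_iff[OF glue_measurable]) (use ij in \<open>auto simp: glue_def\<close>)
qed

end

section \<open>Topological minimal self-joinings\<close>

lemma continuous_power_action:
  assumes "continuous_action T"
  shows "continuous_on UNIV (power_action I T g)"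
proof (rule continuous_on_coordinatewise_then_product)
  fix i :: nat
  have cont: "continuous_on UNIV (\<lambda>x. T g (x i))"
    by (rule continuous_on_compose2[of UNIV "T g"])
      (use assms in \<open>simp_all add: continuous_action_def\<close>)
  show "continuous_on UNIV (\<lambda>x. power_action I T g x i)"
  proof (cases "i \<in> I")
    case True
    then have "(\<lambda>x. power_action I T g x i) = (\<lambda>x. T g (x i))"
      by (simp add: power_action_def)
    with cont show ?thesis by (simp only:)
  next
    case False
    then have "(\<lambda>x. power_action I T g x i) = (\<lambda>_. undefined)"
      by (simp add: power_action_def)
    then show ?thesis by (simp only: continuous_on_const)
  qed
qed

text \<open>
  Each coordinate projection of an invariant measure is invariant, hence equal to \<open>\<mu>\<close> by unique
  ergodicity. The measure \<open>M0\<close> lives on the Borel sets of the full function space, which is a metric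
  space; restriction to \<open>{..<N}\<close> brings it to the product of Borel \<open>\<sigma>\<close>-algebras.
\<close>
lemma self_joining_of_invariant:
  fixes T :: "'g::ab_group_add \<Rightarrow> 'x::metric_space \<Rightarrow> 'x" and M0 :: "(nat \<Rightarrow> 'x) measure"
  assumes act: "continuous_action T" and \<mu>: "invariant_prob T \<mu>" and ue: "uniquely_ergodic T"
    and sets: "sets M0 = sets borel" and prob: "prob_space M0"
    and inv: "\<And>g. distr M0 borel (power_action {..<N} T g) = M0"
  shows "self_joining T \<mu> N (distr M0 (\<Pi>\<^sub>M i\<in>{..<N}. borel) (\<lambda>y. restrict y {..<N}))"
proof -
  have [measurable_cong]: "sets M0 = sets borel" by (rule sets)
  have T [measurable]: "T g \<in> borel \<rightarrow>\<^sub>M borel" for g by (rule measurable_action[OF act])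
  have coord [measurable]: "(\<lambda>y. y i) \<in> borel \<rightarrow>\<^sub>M (borel :: 'x measure)" for i :: nat
    by (intro borel_measurable_continuous_onI continuous_on_product_coordinates)
  have res [measurable]: "(\<lambda>y. restrict y {..<N}) \<in> borel \<rightarrow>\<^sub>M (\<Pi>\<^sub>M i\<in>{..<N}. (borel :: 'x measure))"
    by (intro measurable_restrict coord)
  have S [measurable]: "power_action {..<N} T g \<in> borel \<rightarrow>\<^sub>M borel" for g
    by (intro borel_measurable_continuous_onI continuous_power_action act)
  have S' [measurable]: "power_action {..<N} T g \<in> (\<Pi>\<^sub>M i\<in>{..<N}. borel) \<rightarrow>\<^sub>M (\<Pi>\<^sub>M i\<in>{..<N}. (borel :: 'x measure))" for g
    unfolding power_action_def by measurable
  let ?M = "distr M0 (\<Pi>\<^sub>M i\<in>{..<N}. borel) (\<lambda>y. restrict y {..<N})"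
  have "distr ?M (\<Pi>\<^sub>M i\<in>{..<N}. borel) (power_action {..<N} T g) = ?M" for g
  proof -
    have "distr ?M (\<Pi>\<^sub>M i\<in>{..<N}. borel) (power_action {..<N} T g) =
        distr M0 (\<Pi>\<^sub>M i\<in>{..<N}. borel) (\<lambda>y. restrict (power_action {..<N} T g y) {..<N})"
      by (subst distr_distr) (auto simp: o_def power_action_def cong: restrict_cong)
    also have "\<dots> = distr (distr M0 borel (power_action {..<N} T g)) (\<Pi>\<^sub>M i\<in>{..<N}. borel) (\<lambda>y. restrict y {..<N})"
      by (subst distr_distr) (auto simp: o_def)
    finally show ?thesis unfolding inv .
  qed
  moreover have "distr ?M borel (\<lambda>x. x i) = \<mu>" if "i < N" for i
  proof -
    have eq: "distr ?M borel (\<lambda>x. x i) = distr M0 borel (\<lambda>y. y i)"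
      using that by (subst distr_distr) (auto simp: o_def)
    have "invariant_prob T (distr M0 borel (\<lambda>y. y i))"
      unfolding invariant_prob_def
    proof (intro conjI allI)
      show "prob_space (distr M0 borel (\<lambda>y. y i))"
        by (rule prob_space.prob_space_distr[OF prob]) measurable
      fix g
      have "distr (distr M0 borel (\<lambda>y. y i)) borel (T g) = distr M0 borel (\<lambda>y. power_action {..<N} T g y i)"
        using that by (subst distr_distr) (auto simp: o_def power_action_def)
      also have "\<dots> = distr (distr M0 borel (power_action {..<N} T g)) borel (\<lambda>y. y i)"
        by (subst distr_distr) (auto simp: o_def)
      finally show "distr (distr M0 borel (\<lambda>y. y i)) borel (T g) = distr M0 borel (\<lambda>y. y i)"
        unfolding inv .
    qed simp
    then show ?thesis
      using ue \<mu> unfolding uniquely_ergodic_def eq by blast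
  qed
  ultimately show ?thesis
    unfolding self_joining_def using prob by (auto intro!: prob_space.prob_space_distr)
qed

text \<open>
  Inside the full function space the power is a product of copies of the space and of singletons.
\<close>
lemma compact_power:
  assumes "compact (UNIV :: 'x::topological_space set)"
  shows "compact ({..<N} \<rightarrow>\<^sub>E (UNIV :: 'x set))"
proof -
  let ?S = "\<lambda>i. if i < N then UNIV else {undefined :: 'x}"
  have "compactin (product_topology (\<lambda>_. euclidean) UNIV) (Pi\<^sub>E UNIV ?S)"
    unfolding compactin_PiE using assms by auto
  then have "compact (Pi\<^sub>E UNIV ?S)"
    unfolding euclidean_product_topology by simp
  moreover have "Pi\<^sub>E UNIV ?S = {..<N} \<rightarrow>\<^sub>E UNIV"
  proof (intro set_eqI iffI)
    fix x assume "x \<in> Pi\<^sub>E UNIV ?S"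
    then have x: "x i \<in> ?S i" for i by blast
    have "x i = undefined" if "\<not> i < N" for i using x[of i] that by simp
    then show "x \<in> {..<N} \<rightarrow>\<^sub>E UNIV" by (simp add: PiE_iff extensional_def)
  qed (simp add: PiE_iff extensional_def)
  ultimately show ?thesis by simp
qed

theorem corollary6p5:
  fixes T :: "'g::{countable, ab_group_add} \<Rightarrow> 'x::metric_space \<Rightarrow> 'x"
    and \<mu> :: "'x measure"
    and F :: "nat \<Rightarrow> 'g set"
  assumes "compact (UNIV :: 'x set)"
    and "continuous_action T"
    and "invariant_prob T \<mu>"
    and "folner_sequence F"
    and "tempered F"
    and "minimal_action T"
    and "uniquely_ergodic T"
    and "mixing_all_orders T \<mu>"
    and "min_self_joinings_all_orders T \<mu>"
    and "\<nexists>x y. weakly_asymptotic_pair F T x y"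
  shows "top_min_self_joinings_all_orders T"
  unfolding top_min_self_joinings_all_orders_def top_min_self_joinings_def
proof (intro allI impI ballI)
  note X = assms(1) and act = assms(2) and \<mu> = assms(3)
  have sets_\<mu>: "sets \<mu> = sets borel" and prob_\<mu>: "prob_space \<mu>"
    using \<mu> unfolding invariant_prob_def by auto
  interpret \<mu>: prob_space \<mu> by (rule prob_\<mu>)
  have finF: "finite (F n)" "F n \<noteq> {}" for n
    using assms(4) unfolding folner_sequence_def by auto
  have Tadd: "T (g + h) z = T g (T h z)" and Tcont: "continuous_on UNIV (T g)" for g h z
    using act unfolding continuous_action_def by auto
  fix N :: nat and x :: "nat \<Rightarrow> 'x"
  assume "N \<ge> 2" and x: "x \<in> {..<N} \<rightarrow>\<^sub>E UNIV"
    and distinct: "\<forall>i<N. \<forall>j<N. i \<noteq> j \<longrightarrow> x j \<notin> orbit_of T (x i)"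
  define P where "P = {..<N} \<rightarrow>\<^sub>E (UNIV :: 'x set)"
  define S where "S = power_action {..<N} T"
  have S_apply: "S g y i = T g (y i)" if "i < N" for g y i
    using that by (simp add: S_def power_action_def)
  have SP: "S g y \<in> P" for g y
    by (simp add: S_def power_action_def P_def)
  have Sadd: "S (g + h) y = S g (S h y)" for g h y
    by (auto simp: S_def power_action_def Tadd restrict_def)
  have Scont: "continuous_on UNIV (S g)" for g
    unfolding S_def by (rule continuous_power_action[OF act])
  let ?top = "product_topology (\<lambda>_. euclidean) {..<N} :: (nat \<Rightarrow> 'x) topology"
  have "y \<in> ?top closure_of orbit_of S x" if y: "y \<in> P" for y
  proof (rule ccontr)
    assume "\<not> ?thesis"
    then obtain O' where "openin ?top O'" "y \<in> O'" and O': "O' \<inter> orbit_of S x = {}"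
      using y unfolding in_closure_of P_def by auto
    then obtain U where yU: "y \<in> (\<Pi>\<^sub>E i\<in>{..<N}. U i)" and openU: "\<And>i. open (U i)"
        and UO: "(\<Pi>\<^sub>E i\<in>{..<N}. U i) \<subseteq> O'"
      using product_topology_open_contains_basis[of "\<lambda>_. euclidean" "{..<N}" O' y] by auto
    let ?U = "\<Pi>\<^sub>E i\<in>{..<N}. U i"
    have Upos: "measure \<mu> (U i) > 0" if "i < N" for i
      using that yU by (intro minimal_open_measure_pos[OF act \<mu> assms(6) openU]) auto
    \<comment> \<open>The compact invariant set of all points whose orbit avoids the rectangle.\<close>
    define Y where "Y = {z \<in> P. \<forall>g. S g z \<notin> ?U}"
    have xY: "x \<in> Y"
      using x O' UO unfolding Y_def P_def orbit_of_def by auto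
    have YS: "S g z \<in> Y" if "z \<in> Y" for g z
      using that SP unfolding Y_def by (auto simp: Sadd[symmetric])
    have S0: "S 0 z = z" if "z \<in> P" for z
      using that act unfolding S_def power_action_def continuous_action_def P_def
      by (auto simp: fun_eq_iff PiE_iff extensional_def)
    have "z \<notin> ?U" if "z \<in> Y" for z
    proof -
      from that have "z \<in> P" "S 0 z \<notin> ?U" unfolding Y_def by blast+
      then show ?thesis using S0 by simp
    qed
    then have YU: "Y \<inter> ?U = {}" by blast
    have "compact Y"
    proof -
      have "open {z. \<forall>i<N. S g z i \<in> U i}" for g
      proof -
        have "open ((\<lambda>z. S g z i) -` U i)" for i
          using continuous_on_product_then_coordinatewise[OF Scont] openU
          by (intro open_vimage) auto
        then have "open (\<Inter>i\<in>{..<N}. (\<lambda>z. S g z i) -` U i)" by (intro open_INT) auto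
        also have "(\<Inter>i\<in>{..<N}. (\<lambda>z. S g z i) -` U i) = {z. \<forall>i<N. S g z i \<in> U i}" by auto
        finally show ?thesis .
      qed
      then have "closed (\<Inter>g. - {z. \<forall>i<N. S g z i \<in> U i})"
        by (intro closed_INT) (auto simp: closed_def)
      then have "compact (P \<inter> (\<Inter>g. - {z. \<forall>i<N. S g z i \<in> U i}))"
        using compact_power[OF X] unfolding P_def by (rule compact_Int_closed[rotated])
      also have "P \<inter> (\<Inter>g. - {z. \<forall>i<N. S g z i \<in> U i}) = Y"
      proof -
        have "S g z \<in> ?U \<longleftrightarrow> (\<forall>i<N. S g z i \<in> U i)" for g z
          using SP[of g z] unfolding P_def by (auto simp: PiE_iff)
        then show ?thesis unfolding Y_def by auto
      qed
      finally show ?thesis .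
    qed
    obtain E where finE: "finite E" and E: "\<And>J g. J \<subseteq> {..<N} \<Longrightarrow> J \<noteq> {} \<Longrightarrow>
        (\<And>i j. i \<in> J \<Longrightarrow> j \<in> J \<Longrightarrow> i \<noteq> j \<Longrightarrow> (g i :: 'g) - g j \<notin> E) \<Longrightarrow> measure \<mu> (\<Inter>i\<in>J. T (g i) -` U i) > 0"
    proof (rule mixing_blocks_positive[OF act \<mu> assms(8), of N U])
      show "U i \<in> sets borel" for i using openU by simp
      show "measure \<mu> (U i) > 0" if "i < N" for i using that by (rule Upos)
    qed (use that in blast)
    \<comment> \<open>The function \<open>f\<close> vanishes on the graphs \<open>z i = T h (z j)\<close> with \<open>h\<close> in \<open>E\<close>, and only there.\<close>
    define I where "I = {(i, j, h). i < N \<and> j < N \<and> i \<noteq> j \<and> h \<in> E}"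
    have finI: "finite I"
      by (rule finite_subset[of _ "{..<N} \<times> {..<N} \<times> E"]) (use finE in \<open>auto simp: I_def\<close>)
    define gap where "gap s z = (case s of (i, j, h) \<Rightarrow> dist (z i) (T h (z j)))" for s and z :: "nat \<Rightarrow> 'x"
    define f where "f z = (\<Prod>s\<in>I. gap s z)" for z :: "nat \<Rightarrow> 'x"
    have fcont: "continuous_on UNIV f"
    proof -
      have "continuous_on UNIV (gap s)" for s
      proof (cases s)
        case (fields i j h)
        have "continuous_on UNIV (\<lambda>z :: nat \<Rightarrow> 'x. T h (z j))"
          by (rule continuous_on_compose2[OF Tcont]) auto
        then show ?thesis unfolding gap_def fields by (auto intro!: continuous_intros)
      qed
      then show ?thesis unfolding f_def by (intro continuous_on_prod)
    qed
    \<comment> \<open>Since \<open>x i\<close> and \<open>T k (x j)\<close> are distinct and not weakly asymptotic, each factor is rarely small.\<close>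
    obtain c where c: "c > 0" "\<forall>\<^sub>F n in sequentially. c \<le> (\<Sum>h\<in>F n. f (S h x)) / real (card (F n))"
    proof -
      obtain c where "c > 0"
        "\<forall>\<^sub>F n in sequentially. c \<le> (\<Sum>h\<in>F n. \<Prod>s\<in>I. gap s (S h x)) / real (card (F n))"
      proof (rule average_prod_bounded_below[OF finF finI, of "\<lambda>s h. gap s (S h x)"])
        show "gap s (S h x) \<ge> 0" for s h by (simp add: gap_def split: prod.split)
        fix s and e :: real assume "s \<in> I" "e > 0"
        then obtain i j k where s: "s = (i, j, k)" "i < N" "j < N" "i \<noteq> j" unfolding I_def by auto
        have "gap s (S h x) = dist (T h (x i)) (T h (T k (x j)))" for h
          using s by (simp add: gap_def S_apply Tadd[symmetric] add.commute)
        moreover have "x i \<noteq> T k (x j)"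
          using distinct s unfolding orbit_of_def by auto
        ultimately show "\<exists>\<delta>>0. \<forall>\<^sub>F n in sequentially.
            real (card (F n \<inter> {h. gap s (S h x) < \<delta>})) / real (card (F n)) < e"
          using not_weakly_asymptotic_imp_rarely_close[OF finF(1) _ _ \<open>e > 0\<close>,
            where T = T and x = "x i" and y = "T k (x j)"] assms(10)
          by simp
      qed
      then show ?thesis using that unfolding f_def by blast
    qed
    obtain M0 where M0: "sets M0 = sets borel" "prob_space M0" "\<And>g. distr M0 borel (S g) = M0"
        "measure M0 Y = 1" "(\<integral>z. f z \<partial>M0) > 0"
      and erg0: "\<forall>A\<in>sets borel. (\<forall>g. S g -` A \<inter> Y = A \<inter> Y) \<longrightarrow> measure M0 A = 0 \<or> measure M0 A = 1"
    proof (rule ergodic_measure_with_positive_integral[where S = S and Y = Y and F = F and x = x and f = f and c = c,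
          OF \<open>compact Y\<close> YS Scont Sadd assms(4) xY fcont c(1) eventually_frequently[OF sequentially_bot c(2)]])
      fix M assume M: "sets M = sets borel" "prob_space M" "\<And>g. distr M borel (S g) = M"
        "measure M Y = 1" "(\<integral>z. f z \<partial>M) > 0"
        "\<forall>A\<in>sets borel. (\<forall>g. S g -` A \<inter> Y = A \<inter> Y) \<longrightarrow> measure M A = 0 \<or> measure M A = 1"
      show thesis by (rule that[OF M])
    qed
    interpret M0: prob_space M0 by (rule M0(2))
    define \<rho> where "\<rho> z = restrict z {..<N}" for z :: "nat \<Rightarrow> 'x"
    define M where "M = distr M0 (\<Pi>\<^sub>M i\<in>{..<N}. borel) \<rho>"
    have \<rho>: "\<rho> \<in> borel \<rightarrow>\<^sub>M (\<Pi>\<^sub>M i\<in>{..<N}. borel)"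
      unfolding \<rho>_def
      by (intro measurable_restrict borel_measurable_continuous_onI continuous_on_product_coordinates)
    then have \<rho>': "\<rho> \<in> M0 \<rightarrow>\<^sub>M (\<Pi>\<^sub>M i\<in>{..<N}. borel)"
      using measurable_cong_sets[OF M0(1) refl] by blast
    have spM0: "space M0 = UNIV" using sets_eq_imp_space_eq[OF M0(1)] by simp
    have spM: "space M = P" unfolding M_def P_def by (simp add: space_PiM)
    have \<rho>P: "\<rho> z = z" if "z \<in> P" for z
      using that unfolding P_def \<rho>_def by simp
    have YP: "Y \<subseteq> P" unfolding Y_def by auto
    have mM: "measure M A = measure M0 (\<rho> -` A)" if "A \<in> sets M" for A
      using that \<rho>' spM0 unfolding M_def by (subst measure_distr) auto
    have join: "self_joining T \<mu> N M"
      unfolding M_def \<rho>_def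
      by (rule self_joining_of_invariant[OF act \<mu> assms(7) M0(1,2)]) (use M0(3) in \<open>simp add: S_def\<close>)
    moreover have "ergodic_for (power_action {..<N} T) M"
      unfolding ergodic_for_def
    proof (intro ballI impI)
      fix A assume A: "A \<in> sets M" and inv: "\<forall>g. power_action {..<N} T g -` A \<inter> space M = A"
      have "\<rho> -` A \<in> sets borel"
        using measurable_sets[OF \<rho>, of A] A by (simp add: M_def)
      moreover have "S g -` (\<rho> -` A) \<inter> Y = \<rho> -` A \<inter> Y" for g
      proof -
        have "S g z \<in> A \<longleftrightarrow> z \<in> A" if "z \<in> P" for z
          using inv that unfolding S_def spM by blast
        then show ?thesis using YP \<rho>P SP by auto
      qed
      ultimately show "measure M A = 0 \<or> measure M A = 1"
        unfolding mM[OF A] using erg0 by blast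
    qed
    ultimately have "trivial_joining T \<mu> N M"
      using assms(9) \<open>N \<ge> 2\<close> unfolding min_self_joinings_all_orders_def by blast
    then obtain b :: "nat \<Rightarrow> nat" and g :: "nat \<Rightarrow> 'g" where Mbg: "M = distr (\<Pi>\<^sub>M k\<in>b ` {..<N}. off_diagonal_joining T \<mu> {i. i < N \<and> b i = k} g)
              (\<Pi>\<^sub>M i\<in>{..<N}. borel) (\<lambda>w. \<lambda>i\<in>{..<N}. w (b i) i)"
      unfolding trivial_joining_def by blast
    interpret J: off_diagonal_product T \<mu> N b g
      by standard (rule X act sets_\<mu> prob_\<mu>)+
    have MJ: "M = J.joining"
      unfolding Mbg J.joining_def J.factor_def J.block_def J.glue_def ..
    \<comment> \<open>Otherwise \<open>f\<close> would vanish almost everywhere.\<close>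
    have sep: "g i - g j \<notin> E" if ij: "i < N" "j < N" "i \<noteq> j" "b i = b j" for i j
    proof
      assume "g i - g j \<in> E"
      then have I: "(i, j, g i - g j) \<in> I" using ij by (simp add: I_def)
      have "AE z in M. z i = T (g i - g j) (z j)"
        unfolding MJ using ij by (intro J.AE_joining)
      then have "AE z in M0. \<rho> z i = T (g i - g j) (\<rho> z j)"
        unfolding M_def by (rule AE_distrD[OF \<rho>'])
      then have "AE z in M0. f z = 0"
      proof eventually_elim
        case (elim z)
        then have "gap (i, j, g i - g j) z = 0" using ij by (simp add: gap_def \<rho>_def)
        then show ?case unfolding f_def using finI I by (rule_tac prod_zero) auto
      qed
      then have "(\<integral>z. f z \<partial>M0) = 0" by (rule integral_eq_zero_AE)
      then show False using M0(5) by simp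
    qed
    have "emeasure \<mu> (\<Inter>i\<in>J.block k. T (g i) -` U i) \<noteq> 0" if k: "k \<in> b ` {..<N}" for k
    proof -
      have "measure \<mu> (\<Inter>i\<in>J.block k. T (g i) -` U i) > 0"
        using J.block[of k] k sep by (intro E) (auto simp: J.block_def)
      then show ?thesis by (simp add: \<mu>.emeasure_eq_measure)
    qed
    then have "emeasure M ?U \<noteq> 0"
      unfolding MJ using openU by (subst J.emeasure_joining) auto
    moreover have Umeas: "?U \<in> sets M"
      unfolding M_def sets_distr using openU by (intro sets_PiM_I_finite) auto
    moreover have "measure M ?U = 0"
    proof -
      have Ym: "Y \<in> sets M0" using compact_imp_closed[OF \<open>compact Y\<close>] M0(1) by simp
      have Um: "\<rho> -` ?U \<in> sets M0" using measurable_sets[OF \<rho>', of ?U] Umeas spM0 by (simp add: M_def)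
      have "\<rho> z \<notin> ?U" if "z \<in> Y" for z
        using that YU \<rho>P[OF subsetD[OF YP that]] by auto
      then have "\<rho> -` ?U \<subseteq> space M0 - Y" using spM0 by auto
      then have "measure M0 (\<rho> -` ?U) \<le> measure M0 (space M0 - Y)"
        using Ym by (intro M0.finite_measure_mono) auto
      also have "\<dots> = 0" using M0.prob_compl[OF Ym] M0(4) by simp
      finally show ?thesis using mM[OF Umeas] measure_nonneg[of M0] by (simp add: order_antisym)
    qed
    moreover have "prob_space M" using join unfolding self_joining_def by blast
    ultimately show False
      using finite_measure.emeasure_eq_measure[of M ?U] by (simp add: prob_space_def)
  qed
  then show "?top closure_of orbit_of (power_action {..<N} T) x = {..<N} \<rightarrow>\<^sub>E UNIV"
    using closure_of_subset_topspace[of ?top "orbit_of S x"] unfolding S_def P_def by auto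
qed

end
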